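(* There is a polynomial-time algorithm which, given a non-degenerate financial network with rational data that satisfies the central CDS debtor property and in which every CDS is covered, computes an exact clearing recovery rate vector (under proportional payments).
   Context: A financial network consists of banks, external assets $e_i\in\mathbb{Q}_{\ge0}$, debt contracts with notionals $c_{i,j}\ge0$ (debtor $i$, creditor $j$) and CDSes with notionals $c^k_{i,j}\ge0$ (debtor $i$, creditor $j$, reference bank $k$, all distinct). For recovery rates $r$: liability $l_{i,j}(r)=c_{i,j}+\sum_k(1-r_k)c^k_{i,j}$, $l_i(r)=\sum_jl_{i,j}(r)$, payment $p_{i,j}(r)=r_il_{i,j}(r)$, assets $a_i(r)=e_i+\sum_jp_{j,i}(r)$. A clearing recovery rate vector satisfies $r_i=\min\{1,a_i(r)/l_i(r)\}$ if $l_i(r)>0$ and $r_i=1$ if $l_i(r)=0$, for all banks $i$. Non-degenerate: every reference bank is the debtor of some debt contract and every CDS debtor has positive external assets or is the debtor of some debt contract. Central CDS debtor property: a single bank $\mathcal{CCD}$ is the debtor of every CDS with nonzero notional, $\mathcal{CCD}$ is the debtor of no debt contract, and $e_{\mathcal{CCD}}\ge\sum_{j,R}c^R_{\mathcal{CCD},j}$. A CDS with debtor $i$, creditor $j$ and reference bank $R$ is covered if $c^R_{i,j}\le c_{R,j}$. *)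

theory Defs
  imports Complex_Main "HOL-Library.Log_Nat" "HOL-Computational_Algebra.Polynomial"
begin

section \<open>Financial networks with debt and credit default swaps\<close>

text \<open>
  The banks of \<open>N\<close> are \<open>0, \<dots>, nbanks N - 1\<close>; values of the data at other indices are
  irrelevant.  \<open>debt N i j\<close> is the notional $c_{i,j}$ and \<open>cds N i j k\<close> is $c^k_{i,j}$
  (debtor \<open>i\<close>, creditor \<open>j\<close>, reference bank \<open>k\<close>); notional \<open>0\<close> means that there is
  no such contract.
\<close>

record network =
  nbanks :: nat
  ext :: "nat \<Rightarrow> rat"
  debt :: "nat \<Rightarrow> nat \<Rightarrow> rat"
  cds :: "nat \<Rightarrow> nat \<Rightarrow> nat \<Rightarrow> rat"

definition is_debt :: "network \<Rightarrow> nat \<Rightarrow> nat \<Rightarrow> bool" where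
  "is_debt N i j \<longleftrightarrow> i < nbanks N \<and> j < nbanks N \<and> debt N i j \<noteq> 0"

definition is_cds :: "network \<Rightarrow> nat \<Rightarrow> nat \<Rightarrow> nat \<Rightarrow> bool" where
  "is_cds N i j k \<longleftrightarrow>
     i < nbanks N \<and> j < nbanks N \<and> k < nbanks N \<and> cds N i j k \<noteq> 0"

definition financial_network :: "network \<Rightarrow> bool" where
  "financial_network N \<longleftrightarrow>
     (\<forall>i < nbanks N. 0 \<le> ext N i) \<and>
     (\<forall>i < nbanks N. \<forall>j < nbanks N. 0 \<le> debt N i j) \<and>
     (\<forall>i < nbanks N. \<forall>j < nbanks N. \<forall>k < nbanks N. 0 \<le> cds N i j k) \<and>
     (\<forall>i j k. is_cds N i j k \<longrightarrow> i \<noteq> j \<and> i \<noteq> k \<and> j \<noteq> k)"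

definition liability_to :: "network \<Rightarrow> (nat \<Rightarrow> rat) \<Rightarrow> nat \<Rightarrow> nat \<Rightarrow> rat" where
  "liability_to N r i j = debt N i j + (\<Sum>k < nbanks N. (1 - r k) * cds N i j k)"

definition liability :: "network \<Rightarrow> (nat \<Rightarrow> rat) \<Rightarrow> nat \<Rightarrow> rat" where
  "liability N r i = (\<Sum>j < nbanks N. liability_to N r i j)"

definition payment :: "network \<Rightarrow> (nat \<Rightarrow> rat) \<Rightarrow> nat \<Rightarrow> nat \<Rightarrow> rat" where
  "payment N r i j = r i * liability_to N r i j"

definition assets :: "network \<Rightarrow> (nat \<Rightarrow> rat) \<Rightarrow> nat \<Rightarrow> rat" where
  "assets N r i = ext N i + (\<Sum>j < nbanks N. payment N r j i)"

definition clearing :: "network \<Rightarrow> (nat \<Rightarrow> rat) \<Rightarrow> bool" where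
  "clearing N r \<longleftrightarrow>
     (\<forall>i < nbanks N.
        0 \<le> r i \<and> r i \<le> 1 \<and>
        (liability N r i > 0 \<longrightarrow> r i = min 1 (assets N r i / liability N r i)) \<and>
        (liability N r i = 0 \<longrightarrow> r i = 1))"

definition nondegenerate :: "network \<Rightarrow> bool" where
  "nondegenerate N \<longleftrightarrow>
     (\<forall>i j k. is_cds N i j k \<longrightarrow>
        (\<exists>m. is_debt N k m) \<and> (0 < ext N i \<or> (\<exists>m. is_debt N i m)))"

definition central_cds_debtor :: "network \<Rightarrow> nat \<Rightarrow> bool" where
  "central_cds_debtor N d \<longleftrightarrow>
     d < nbanks N \<and>
     (\<forall>i j k. is_cds N i j k \<longrightarrow> i = d) \<and>
     (\<forall>j. \<not> is_debt N d j) \<and>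
     (\<Sum>j < nbanks N. \<Sum>k < nbanks N. cds N d j k) \<le> ext N d"

definition central_cds_debtor_property :: "network \<Rightarrow> bool" where
  "central_cds_debtor_property N \<longleftrightarrow> (\<exists>d. central_cds_debtor N d)"

definition covered :: "network \<Rightarrow> nat \<Rightarrow> nat \<Rightarrow> nat \<Rightarrow> bool" where
  "covered N i j k \<longleftrightarrow> cds N i j k \<le> debt N k j"

definition all_cds_covered :: "network \<Rightarrow> bool" where
  "all_cds_covered N \<longleftrightarrow> (\<forall>i j k. is_cds N i j k \<longrightarrow> covered N i j k)"


section \<open>Polynomial time on a random access machine\<close>

text \<open>
  Polynomial time is taken on a structured random access machine under the logarithmic cost
  criterion.  The memory consists of named arrays of integers; a program mentions only
  finitely many array names, and a scalar variable is an array used at index \<open>0\<close> only.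
  Every operation is charged the binary lengths of its operands and of the addresses used, and
  multiplication and division are charged the product of the lengths of their operands (the cost
  of the schoolbook algorithms).  No operation is therefore cheaper, up to a polynomial factor,
  than on a Turing machine, and the two models have the same polynomial time computations.
\<close>

type_synonym vname = string
type_synonym state = "vname \<Rightarrow> int \<Rightarrow> int"

datatype aexp =
    Const int
  | Read vname aexp
  | Add aexp aexp
  | Sub aexp aexp
  | Mul aexp aexp
  | Quo aexp aexp

datatype bexp =
    Less aexp aexp
  | Neg bexp
  | Conj bexp bexp

datatype com =
    Skip
  | Write vname aexp aexp  \<comment> \<open>\<open>Write x a b\<close> is the assignment \<open>x[a] := b\<close>\<close>
  | Seq com com
  | Cond bexp com com
  | Loop bexp com

text \<open>Length in binary, including one sign bit.\<close>

definition int_size :: "int \<Rightarrow> nat" where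
  "int_size k = 1 + floorlog 2 (nat \<bar>k\<bar>)"

primrec aval :: "aexp \<Rightarrow> state \<Rightarrow> int" where
  "aval (Const k) s = k"
| "aval (Read x a) s = s x (aval a s)"
| "aval (Add a b) s = aval a s + aval b s"
| "aval (Sub a b) s = aval a s - aval b s"
| "aval (Mul a b) s = aval a s * aval b s"
| "aval (Quo a b) s = aval a s div aval b s"

primrec acost :: "aexp \<Rightarrow> state \<Rightarrow> nat" where
  "acost (Const k) s = int_size k"
| "acost (Read x a) s = acost a s + int_size (aval a s) + int_size (s x (aval a s))"
| "acost (Add a b) s = acost a s + acost b s + int_size (aval a s) + int_size (aval b s)"
| "acost (Sub a b) s = acost a s + acost b s + int_size (aval a s) + int_size (aval b s)"
| "acost (Mul a b) s = acost a s + acost b s + int_size (aval a s) * int_size (aval b s)"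
| "acost (Quo a b) s = acost a s + acost b s + int_size (aval a s) * int_size (aval b s)"

primrec bval :: "bexp \<Rightarrow> state \<Rightarrow> bool" where
  "bval (Less a b) s \<longleftrightarrow> aval a s < aval b s"
| "bval (Neg b) s \<longleftrightarrow> \<not> bval b s"
| "bval (Conj b c) s \<longleftrightarrow> bval b s \<and> bval c s"

primrec bcost :: "bexp \<Rightarrow> state \<Rightarrow> nat" where
  "bcost (Less a b) s = acost a s + acost b s + int_size (aval a s) + int_size (aval b s)"
| "bcost (Neg b) s = 1 + bcost b s"
| "bcost (Conj b c) s = 1 + bcost b s + bcost c s"

text \<open>\<open>exec c s t s'\<close>: started in \<open>s\<close>, program \<open>c\<close> halts in \<open>s'\<close> after time \<open>t\<close>.\<close>

inductive exec :: "com \<Rightarrow> state \<Rightarrow> nat \<Rightarrow> state \<Rightarrow> bool" where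
  Skip: "exec Skip s 1 s"
| Write: "exec (Write x a b) s
            (acost a s + acost b s + int_size (aval a s) + int_size (aval b s))
            (s(x := (s x)(aval a s := aval b s)))"
| Seq: "exec c s t s' \<Longrightarrow> exec d s' u s'' \<Longrightarrow> exec (Seq c d) s (t + u) s''"
| CondTrue: "bval b s \<Longrightarrow> exec c s t s' \<Longrightarrow> exec (Cond b c d) s (bcost b s + t) s'"
| CondFalse: "\<not> bval b s \<Longrightarrow> exec d s t s' \<Longrightarrow> exec (Cond b c d) s (bcost b s + t) s'"
| LoopFalse: "\<not> bval b s \<Longrightarrow> exec (Loop b c) s (bcost b s) s"
| LoopTrue: "bval b s \<Longrightarrow> exec c s t s' \<Longrightarrow> exec (Loop b c) s' u s'' \<Longrightarrow>
            exec (Loop b c) s (bcost b s + t + u) s''"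

text \<open>Execution is deterministic, so a program has at most one halting time and final state.\<close>

inductive_cases Skip_exec: "exec Skip s t s'"
inductive_cases Write_exec: "exec (Write x a b) s t s'"
inductive_cases Seq_exec: "exec (Seq c d) s t s'"
inductive_cases Cond_exec: "exec (Cond b c d) s t s'"
inductive_cases Loop_exec: "exec (Loop b c) s t s'"

lemma exec_deterministic:
  "exec c s t s' \<Longrightarrow> exec c s u s'' \<Longrightarrow> t = u \<and> s' = s''"
proof (induction arbitrary: u s'' rule: exec.induct)
  case Skip
  from Skip.prems show ?case by (rule Skip_exec) simp
next
  case Write
  from Write.prems show ?case by (rule Write_exec) simp
next
  case Seq
  from Seq.prems show ?case by (rule Seq_exec) (metis Seq.IH)
next
  case CondTrue
  from CondTrue.prems show ?case by (rule Cond_exec) (metis CondTrue.IH CondTrue.hyps(1))+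
next
  case CondFalse
  from CondFalse.prems show ?case by (rule Cond_exec) (metis CondFalse.IH CondFalse.hyps(1))+
next
  case LoopFalse
  from LoopFalse.prems show ?case by (rule Loop_exec) (use LoopFalse.hyps in simp_all)
next
  case LoopTrue
  from LoopTrue.prems show ?case by (rule Loop_exec) (metis LoopTrue.IH LoopTrue.hyps(1))+
qed

text \<open>
  An array stores a list by its length at index \<open>0\<close>, followed by the entries.  The input is
  placed in the array \<open>''in''\<close> with all other memory cells \<open>0\<close>, and the output is read from
  the array \<open>''out''\<close>.
\<close>

definition input_state :: "int list \<Rightarrow> state" where
  "input_state zs = (\<lambda>x i.
     if x = ''in'' \<and> i = 0 then int (length zs)
     else if x = ''in'' \<and> 1 \<le> i \<and> i \<le> int (length zs) then zs ! nat (i - 1)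
     else 0)"

definition has_output :: "state \<Rightarrow> int list \<Rightarrow> bool" where
  "has_output s zs \<longleftrightarrow>
     s ''out'' 0 = int (length zs) \<and> (\<forall>i < length zs. s ''out'' (int i + 1) = zs ! i)"

definition input_size :: "int list \<Rightarrow> nat" where
  "input_size zs = (\<Sum>z\<leftarrow>zs. int_size z)"

text \<open>
  Search problems: for every instance \<open>x\<close> with \<open>P x\<close>, find some \<open>y\<close> with \<open>R x y\<close>.  The
  relations \<open>I\<close> and \<open>J\<close> say which integer lists encode which instances and which solutions.
\<close>

definition solvable_in_poly_time ::
  "(int list \<Rightarrow> 'a \<Rightarrow> bool) \<Rightarrow> (int list \<Rightarrow> 'b \<Rightarrow> bool) \<Rightarrow> ('a \<Rightarrow> bool) \<Rightarrow> ('a \<Rightarrow> 'b \<Rightarrow> bool) \<Rightarrow> bool"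
where
  "solvable_in_poly_time I J P R \<longleftrightarrow>
     (\<exists>(c :: com) (p :: nat poly). \<forall>x zs. P x \<and> I zs x \<longrightarrow>
        (\<exists>t s. exec c (input_state zs) t s \<and> t \<le> poly p (input_size zs) \<and>
           (\<exists>ys y. has_output s ys \<and> J ys y \<and> R x y)))"


section \<open>Encoding of networks and recovery rate vectors\<close>

text \<open>
  Rational numbers are encoded in binary as a numerator followed by a positive denominator,
  not necessarily in lowest terms.
\<close>

definition encodes_rats :: "int list \<Rightarrow> rat list \<Rightarrow> bool" where
  "encodes_rats zs xs \<longleftrightarrow>
     length zs = 2 * length xs \<and>
     (\<forall>i < length xs. zs ! (2 * i + 1) > 0 \<and>
        xs ! i = of_int (zs ! (2 * i)) / of_int (zs ! (2 * i + 1)))"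

text \<open>
  A network is given by the number \<open>n\<close> of banks and all notionals, zeros included.  Since the
  external assets alone already contribute \<open>n\<close> entries, the at most $n^2 + n^3$ entries for absent
  contracts change the input size only polynomially compared with a list of the contracts.
\<close>

definition network_data :: "network \<Rightarrow> rat list" where
  "network_data N = (let bs = [0..<nbanks N] in
     map (ext N) bs @
     [debt N i j. i \<leftarrow> bs, j \<leftarrow> bs] @
     [cds N i j k. i \<leftarrow> bs, j \<leftarrow> bs, k \<leftarrow> bs])"

definition encodes_network :: "int list \<Rightarrow> network \<Rightarrow> bool" where
  "encodes_network zs N \<longleftrightarrow>
     (\<exists>ds. zs = int (nbanks N) # ds \<and> encodes_rats ds (network_data N))"

definition clearing_recovery_rate_vector :: "network \<Rightarrow> rat list \<Rightarrow> bool" where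
  "clearing_recovery_rate_vector N rs \<longleftrightarrow> length rs = nbanks N \<and> clearing N (\<lambda>i. rs ! i)"

end

theory Submission
  imports "Jordan_Normal_Form.Determinant" Defs
begin

text \<open>
  The central debtor always pays in full, so each bank receives the full notional of its credit
  default swaps minus the share of the reference bank that recovers.  Coverage makes the
  coefficient $c_{k,i} - c^k_{d,i}$ of $r_k$ in the assets of bank \<open>i\<close> nonnegative, and clearing
  becomes the fixed point problem of Eisenberg and Noe with monotone piecewise linear right hand
  sides.  For the deficits $1 - r_i$ this is a linear complementarity problem with a Z-matrix, which
  is solved by Chandrasekaran's method: while some bank outside the set \<open>D\<close> of defaulting banks
  cannot pay in full, pivot on its diagonal entry and add it to \<open>D\<close>.  No bank ever leaves \<open>D\<close>, so
  there are at most \<open>n\<close> pivots.  Fraction-free pivoting keeps all entries of the tableau equal to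
  determinants of submatrices of the input matrix, whose lengths are polynomial in the input size.
\<close>

section \<open>Running times and correctness of programs\<close>

text \<open>A linear complementarity problem with a Z-matrix can be infeasible, and then the pivots
  need not stay positive. Here total default, the deficit vector of all ones, is feasible: at
  \<open>r = 0\<close> nothing is paid on debt, and the slack of a row is made of external assets
  and credit default swap notionals. This is the inequality between right hand side and row sum in
  \<open>pivot_invariant\<close>. It survives pivoting, makes the next pivot positive and bounds all
  deficits by 1. Banks without debt must get rate 1, so the invariant also follows the sign of the
  diagonal to keep them out of \<open>D\<close>. Under logarithmic cost, counting steps is worthless
  without control of the memory cells. Both are governed by one number \<open>w\<close>: no cell is
  longer than \<open>w\<close>, no loop runs more than \<open>w\<close> times, and the time is a
  polynomial in \<open>w\<close> that depends on the program text only. The determinant bound is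
  proved for all sets \<open>D\<close> at once, so it does not depend on the course of the
  computation; determinants of size \<open>n \<le> t\<close> with entries of length linear in the
  input size \<open>t\<close> make \<open>w\<close> quadratic in \<open>t\<close>.\<close>

lemma int_size_pos: "1 \<le> int_size k"
  by (simp add: int_size_def)

lemma int_size_le_iff: "int_size k \<le> Suc w \<longleftrightarrow> \<bar>k\<bar> < 2 ^ w"
proof -
  have "int_size k \<le> Suc w \<longleftrightarrow> floorlog 2 (nat \<bar>k\<bar>) \<le> w"
    by (simp add: int_size_def)
  also have "\<dots> \<longleftrightarrow> nat \<bar>k\<bar> < 2 ^ w"
    by (simp add: floorlog_le_iff)
  also have "\<dots> \<longleftrightarrow> \<bar>k\<bar> < 2 ^ w"
    by (simp add: nat_less_iff)
  finally show ?thesis .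
qed

lemma abs_less_power_int_size: "\<bar>k\<bar> < 2 ^ (int_size k - 1)"
  using int_size_le_iff[of k "int_size k - 1"] int_size_pos[of k] by simp

lemma int_size_add: "int_size (a + b) \<le> int_size a + int_size b"
proof -
  obtain m n where mn: "int_size a = Suc m" "int_size b = Suc n"
    using int_size_pos[of a] int_size_pos[of b] by (cases "int_size a"; cases "int_size b") auto
  have "(2::int) ^ m \<le> 2 ^ (m + n)" "(2::int) ^ n \<le> 2 ^ (m + n)"
    by (simp_all add: power_increasing)
  moreover have "\<bar>a\<bar> < 2 ^ m" "\<bar>b\<bar> < 2 ^ n"
    using mn int_size_le_iff[of a m] int_size_le_iff[of b n] by simp_all
  ultimately have "\<bar>a + b\<bar> < 2 ^ Suc (m + n)"
    unfolding power_Suc by linarith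
  then have "int_size (a + b) \<le> Suc (Suc (m + n))"
    by (simp only: int_size_le_iff)
  then show ?thesis
    using mn by simp
qed

lemma int_size_minus [simp]: "int_size (- a) = int_size a"
  by (simp add: int_size_def)

lemma int_size_diff: "int_size (a - b) \<le> int_size a + int_size b"
  using int_size_add[of a "- b"] by simp

lemma int_size_mult: "int_size (a * b) \<le> int_size a + int_size b"
proof -
  let ?a = "int_size a - 1" and ?b = "int_size b - 1"
  have "\<bar>a * b\<bar> < 2 ^ (?a + ?b)"
    unfolding abs_mult power_add
    by (intro mult_strict_mono' abs_less_power_int_size) simp_all
  then have "int_size (a * b) \<le> Suc (?a + ?b)"
    by (simp only: int_size_le_iff)
  then show ?thesis
    using int_size_pos[of a] int_size_pos[of b] by simp
qed

lemma int_size_mono: "\<bar>a\<bar> \<le> \<bar>b\<bar> \<Longrightarrow> int_size a \<le> int_size b"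
  using int_size_le_iff[of a "int_size b - 1"] abs_less_power_int_size[of b] int_size_pos[of b]
  by simp

text \<open>\<open>div\<close> rounds down, so for \<open>b > 0\<close> and negative
  \<open>a\<close> the quotient lies between \<open>a\<close> and \<open>-1\<close>. A negative
  divisor is reduced to a positive one by negating both arguments.\<close>

lemma abs_div_le: "\<bar>a div b\<bar> \<le> \<bar>a\<bar>" for a b :: int
proof (cases "b = 0")
  case False
  then have b: "1 \<le> \<bar>b\<bar>" by simp
  have *: "\<bar>a div b\<bar> \<le> \<bar>a\<bar>" if "0 < b" for a b :: int
  proof (cases "0 \<le> a")
    case True
    then have "a div b \<le> a div 1" using that by (intro zdiv_mono2) simp_all
    moreover have "0 \<le> a div b" using True that by (simp add: pos_imp_zdiv_nonneg_iff)
    ultimately show ?thesis using True by simp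
  next
    case False
    then have "a div 1 \<le> a div b" using that by (intro zdiv_mono2_neg) simp_all
    moreover have "a div b < 0" using False that by (simp add: pos_imp_zdiv_neg_iff)
    ultimately show ?thesis using False by simp
  qed
  show ?thesis
    using *[of b a] *[of "- b" "- a"] False by (cases "0 < b") simp_all
qed simp

lemma int_size_div: "int_size (a div b) \<le> int_size a"
  by (intro int_size_mono abs_div_le)

section \<open>Cost of expressions in states with uniformly bounded cells\<close>

definition bounded_state :: "nat \<Rightarrow> state \<Rightarrow> bool" where
  "bounded_state w s \<longleftrightarrow> (\<forall>x i. int_size (s x i) \<le> w)"

text \<open>One expression lengthens numbers by a constant factor at most: lengths add up under
  multiplication, and whatever is read from memory has length at most \<open>w\<close>
  again.\<close>

primrec size_factor :: "aexp \<Rightarrow> nat" where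
  "size_factor (Const k) = int_size k"
| "size_factor (Read x a) = 1"
| "size_factor (Add a b) = size_factor a + size_factor b"
| "size_factor (Sub a b) = size_factor a + size_factor b"
| "size_factor (Mul a b) = size_factor a + size_factor b"
| "size_factor (Quo a b) = size_factor a"

lemma int_size_aval:
  assumes "bounded_state w s"
  shows "int_size (aval a s) \<le> size_factor a * w"
proof (induction a)
  case (Const k)
  have "1 \<le> w"
    using assms int_size_pos le_trans unfolding bounded_state_def by blast
  then show ?case by simp
next
  case (Read x a)
  then show ?case using assms by (simp add: bounded_state_def)
next
  case (Add a b)
  then show ?case
    using int_size_add[of "aval a s" "aval b s"] by (simp add: add_mult_distrib)
next
  case (Sub a b)
  then show ?case
    using int_size_diff[of "aval a s" "aval b s"] by (simp add: add_mult_distrib)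
next
  case (Mul a b)
  then show ?case
    using int_size_mult[of "aval a s" "aval b s"] by (simp add: add_mult_distrib)
next
  case (Quo a b)
  then show ?case
    using int_size_div[of "aval a s" "aval b s"] by simp
qed

primrec acost_poly :: "aexp \<Rightarrow> nat poly" where
  "acost_poly (Const k) = [:int_size k:]"
| "acost_poly (Read x a) = acost_poly a + [:0, size_factor a + 1:]"
| "acost_poly (Add a b) = acost_poly a + acost_poly b + [:0, size_factor a + size_factor b:]"
| "acost_poly (Sub a b) = acost_poly a + acost_poly b + [:0, size_factor a + size_factor b:]"
| "acost_poly (Mul a b) = acost_poly a + acost_poly b + [:0, size_factor a:] * [:0, size_factor b:]"
| "acost_poly (Quo a b) = acost_poly a + acost_poly b + [:0, size_factor a:] * [:0, size_factor b:]"

lemma acost_le: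
  assumes "bounded_state w s"
  shows "acost a s \<le> poly (acost_poly a) w"
proof (induction a)
  case (Read x a)
  have "int_size (s x (aval a s)) \<le> w"
    using assms by (simp add: bounded_state_def)
  then show ?case
    using Read int_size_aval[OF assms, of a] by (simp add: algebra_simps)
next
  case (Mul a b)
  then show ?case
    using mult_mono[OF int_size_aval[OF assms, of a] int_size_aval[OF assms, of b]]
    by (simp add: algebra_simps)
next
  case (Quo a b)
  then show ?case
    using mult_mono[OF int_size_aval[OF assms, of a] int_size_aval[OF assms, of b]]
    by (simp add: algebra_simps)
next
  case (Add a b)
  then show ?case
    using int_size_aval[OF assms, of a] int_size_aval[OF assms, of b] by (simp add: algebra_simps)
next
  case (Sub a b)
  then show ?case
    using int_size_aval[OF assms, of a] int_size_aval[OF assms, of b] by (simp add: algebra_simps)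
qed simp

primrec bcost_poly :: "bexp \<Rightarrow> nat poly" where
  "bcost_poly (Less a b) = acost_poly a + acost_poly b + [:0, size_factor a + size_factor b:]"
| "bcost_poly (Neg b) = 1 + bcost_poly b"
| "bcost_poly (Conj b c) = 1 + bcost_poly b + bcost_poly c"

lemma bcost_le:
  assumes "bounded_state w s"
  shows "bcost b s \<le> poly (bcost_poly b) w"
proof (induction b)
  case (Less a b)
  then show ?case
    using int_size_aval[OF assms, of a] int_size_aval[OF assms, of b]
      acost_le[OF assms, of a] acost_le[OF assms, of b] by (simp add: algebra_simps)
qed simp_all

text \<open>
  A bound for the running time in a parameter that bounds the lengths of all memory cells and
  the number of iterations of every loop, each time it is entered.
\<close>

primrec time_poly :: "com \<Rightarrow> nat poly" where
  "time_poly Skip = 1"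
| "time_poly (Write x a b) = bcost_poly (Less a b)"
| "time_poly (Seq c d) = time_poly c + time_poly d"
| "time_poly (Cond b c d) = bcost_poly b + time_poly c + time_poly d"
| "time_poly (Loop b c) = bcost_poly b + [:0, 1:] * (bcost_poly b + time_poly c)"

text \<open>Since \<open>bounded_state w\<close> is assumed before and guaranteed after each
  command, it never has to appear in a loop invariant; the only size obligation left is that each
  assigned value has length at most \<open>w\<close>.\<close>

definition achieves :: "nat \<Rightarrow> com \<Rightarrow> (state \<Rightarrow> bool) \<Rightarrow> state \<Rightarrow> bool" where
  "achieves w c Q s \<longleftrightarrow> (bounded_state w s \<longrightarrow>
     (\<exists>t s'. exec c s t s' \<and> t \<le> poly (time_poly c) w \<and> bounded_state w s' \<and> Q s'))"

lemma achieves_mono: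
  "achieves w c P s \<Longrightarrow> (\<And>s'. P s' \<Longrightarrow> Q s') \<Longrightarrow> achieves w c Q s"
  unfolding achieves_def by blast

abbreviation store :: "state \<Rightarrow> vname \<Rightarrow> int \<Rightarrow> int \<Rightarrow> state" where
  "store s x i v \<equiv> s(x := (s x)(i := v))"

lemma achieves_Write:
  assumes "int_size (aval b s) \<le> w" and "Q (store s x (aval a s) (aval b s))"
  shows "achieves w (Write x a b) Q s"
  unfolding achieves_def
proof (intro impI exI conjI)
  assume s: "bounded_state w s"
  show "acost a s + acost b s + int_size (aval a s) + int_size (aval b s)
      \<le> poly (time_poly (Write x a b)) w"
    using bcost_le[OF s, of "Less a b"] by simp
  show "bounded_state w (store s x (aval a s) (aval b s))"
    using s assms(1) by (simp add: bounded_state_def)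
qed (rule exec.Write, rule assms(2))

lemma achieves_Seq:
  assumes "achieves w c (achieves w d Q) s"
  shows "achieves w (Seq c d) Q s"
  unfolding achieves_def
proof
  assume "bounded_state w s"
  with assms obtain t s' where 1: "exec c s t s'" "t \<le> poly (time_poly c) w"
      and "bounded_state w s'" "achieves w d Q s'"
    unfolding achieves_def by blast
  then obtain u s'' where 2: "exec d s' u s''" "u \<le> poly (time_poly d) w"
      and "bounded_state w s''" "Q s''"
    unfolding achieves_def by blast
  then show "\<exists>t s'. exec (Seq c d) s t s' \<and> t \<le> poly (time_poly (Seq c d)) w
      \<and> bounded_state w s' \<and> Q s'"
    using exec.Seq[OF 1(1) 2(1)] 1(2) 2(2) by (auto intro!: exI add_mono)
qed

lemma achieves_Cond:
  assumes "bval b s \<Longrightarrow> achieves w c Q s" and "\<not> bval b s \<Longrightarrow> achieves w d Q s"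
  shows "achieves w (Cond b c d) Q s"
  unfolding achieves_def
proof
  assume s: "bounded_state w s"
  note b = bcost_le[OF s, of b]
  show "\<exists>t s'. exec (Cond b c d) s t s' \<and> t \<le> poly (time_poly (Cond b c d)) w
      \<and> bounded_state w s' \<and> Q s'"
  proof (cases "bval b s")
    case True
    with assms(1) s obtain t s' where 1: "exec c s t s'" "t \<le> poly (time_poly c) w"
        "bounded_state w s'" "Q s'"
      unfolding achieves_def by blast
    then show ?thesis
      using exec.CondTrue[OF True 1(1)] b by (auto intro!: exI)
  next
    case False
    with assms(2) s obtain t s' where 1: "exec d s t s'" "t \<le> poly (time_poly d) w"
        "bounded_state w s'" "Q s'"
      unfolding achieves_def by blast
    then show ?thesis
      using exec.CondFalse[OF False 1(1), of c] b by (auto intro!: exI)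
  qed
qed

text \<open>The measure \<open>m\<close> yields termination and also, through
  \<open>m s \<le> w\<close>, the bound on the number of iterations. The summand \<open>?b\<close>
  in the proof pays for the last, failing test.\<close>

lemma achieves_Loop:
  assumes inv: "\<And>s. I s \<Longrightarrow> bval b s \<Longrightarrow> achieves w c (\<lambda>s'. I s' \<and> m s' < m s) s"
    and "I s" and "m s \<le> w"
    and Q: "\<And>s. I s \<Longrightarrow> \<not> bval b s \<Longrightarrow> Q s"
  shows "achieves w (Loop b c) Q s"
  unfolding achieves_def
proof
  let ?b = "poly (bcost_poly b) w" and ?c = "poly (time_poly c) w"
  assume "bounded_state w s"
  with \<open>I s\<close> have "\<exists>t s'. exec (Loop b c) s t s' \<and> t \<le> ?b + m s * (?b + ?c)
      \<and> bounded_state w s' \<and> Q s'"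
  proof (induction "m s" arbitrary: s rule: less_induct)
    case less
    note b = bcost_le[OF less.prems(2), of b]
    show ?case
    proof (cases "bval b s")
      case True
      from inv[OF less.prems(1) True] less.prems(2) obtain t s'
        where 1: "exec c s t s'" "t \<le> ?c" and s': "bounded_state w s'" "I s'" "m s' < m s"
        unfolding achieves_def by blast
      from less.hyps[OF s'(3,2,1)] obtain u s''
        where 2: "exec (Loop b c) s' u s''" "u \<le> ?b + m s' * (?b + ?c)"
          and "bounded_state w s''" "Q s''"
        by blast
      moreover have "bcost b s + t + u \<le> ?b + m s * (?b + ?c)"
      proof -
        have "bcost b s + t + u \<le> ?b + Suc (m s') * (?b + ?c)"
          using b 1(2) 2(2) by simp
        also have "\<dots> \<le> ?b + m s * (?b + ?c)"
          using s'(3) by (intro add_left_mono mult_right_mono) simp_all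
        finally show ?thesis .
      qed
      ultimately show ?thesis
        using exec.LoopTrue[OF True 1(1) 2(1)] by blast
    next
      case False
      then show ?thesis
        using exec.LoopFalse[OF False, of c] b less.prems Q by (auto intro!: exI)
    qed
  qed
  moreover have "?b + m s * (?b + ?c) \<le> poly (time_poly (Loop b c)) w"
    using mult_le_mono1[OF assms(3), of "?b + ?c"] by simp
  ultimately show "\<exists>t s'. exec (Loop b c) s t s' \<and> t \<le> poly (time_poly (Loop b c)) w
      \<and> bounded_state w s' \<and> Q s'"
    by (meson le_trans)
qed

section \<open>Fraction-free pivoting\<close>

lemma mult_mat_vec_index:
  "A \<in> carrier_mat n n \<Longrightarrow> v \<in> carrier_vec n \<Longrightarrow> r < n \<Longrightarrow>
    (A *\<^sub>v v) $ r = (\<Sum>c<n. A $$ (r, c) * v $ c)"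
  by (auto simp: scalar_prod_def intro!: sum.cong)

text \<open>Laplace expansion along column \<open>k\<close>: the cofactors there do not see column
  \<open>k\<close>, so they are those of \<open>A\<close>.\<close>

lemma det_replace_col:
  assumes A: "A \<in> carrier_mat n n" and b: "b \<in> carrier_vec n" and k: "k < n"
  shows "det (replace_col A b k) = (adj_mat A *\<^sub>v b) $ k"
proof -
  let ?Ab = "replace_col A b k"
  have Ab: "?Ab \<in> carrier_mat n n" using A by (auto simp: replace_col_def)
  have "det ?Ab = (\<Sum>r<n. ?Ab $$ (r, k) * cofactor ?Ab r k)"
    by (rule laplace_expansion_column[OF Ab k])
  also have "\<dots> = (\<Sum>r = 0..<n. cofactor A r k * b $ r)"
  proof (rule sum.cong)
    fix r assume "r \<in> {0..<n}"
    moreover have "mat_delete ?Ab r k = mat_delete A r k"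
      using A by (auto intro!: eq_matI simp: replace_col_def mat_delete_def)
    ultimately show "?Ab $$ (r, k) * cofactor ?Ab r k = cofactor A r k * b $ r"
      using A k by (simp add: cofactor_def replace_col_def)
  qed auto
  also have "\<dots> = (adj_mat A *\<^sub>v b) $ k"
    using A b k by (auto simp: adj_mat_def scalar_prod_def intro!: sum.cong)
  finally show ?thesis .
qed

text \<open>
  By Cramer's rule the tableau of Gauss--Jordan elimination on the columns \<open>D\<close> has the entries
  \<open>tableau n a D c k / pivot_det n a D\<close>.
\<close>

definition basis_mat :: "nat \<Rightarrow> (nat \<Rightarrow> nat \<Rightarrow> int) \<Rightarrow> nat set \<Rightarrow> int mat" where
  "basis_mat n a D = mat n n (\<lambda>(r, c). if c \<in> D then a r c else of_bool (r = c))"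

definition pivot_det :: "nat \<Rightarrow> (nat \<Rightarrow> nat \<Rightarrow> int) \<Rightarrow> nat set \<Rightarrow> int" where
  "pivot_det n a D = det (basis_mat n a D)"

definition tableau :: "nat \<Rightarrow> (nat \<Rightarrow> nat \<Rightarrow> int) \<Rightarrow> nat set \<Rightarrow> nat \<Rightarrow> nat \<Rightarrow> int" where
  "tableau n a D c k = det (replace_col (basis_mat n a D) (vec n (\<lambda>r. a r k)) c)"

lemma basis_mat_carrier [simp]: "basis_mat n a D \<in> carrier_mat n n"
  by (simp add: basis_mat_def)

lemma basis_mat_empty: "basis_mat n a {} = 1\<^sub>m n"
  by (rule eq_matI) (auto simp: basis_mat_def)

lemma pivot_det_empty [simp]: "pivot_det n a {} = 1"
  by (simp add: pivot_det_def basis_mat_empty)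

lemma adj_mat_one: "adj_mat (1\<^sub>m n) = (1\<^sub>m n :: 'a :: comm_ring_1 mat)"
  using adj_mat(1,2)[of "1\<^sub>m n :: 'a mat" n] by (auto intro: eq_matI)

lemma tableau_empty: "c < n \<Longrightarrow> tableau n a {} c k = a c k"
  by (simp add: tableau_def basis_mat_empty det_replace_col[of _ n] adj_mat_one)

lemma basis_mat_insert:
  "i < n \<Longrightarrow> basis_mat n a (insert i D) = replace_col (basis_mat n a D) (vec n (\<lambda>r. a r i)) i"
  by (rule eq_matI) (auto simp: basis_mat_def replace_col_def)

text \<open>The entry on which the pivot is made is thus the common denominator of the next
  tableau.\<close>

lemma pivot_det_insert: "i < n \<Longrightarrow> pivot_det n a (insert i D) = tableau n a D i i"
  by (simp add: pivot_det_def tableau_def basis_mat_insert)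

text \<open>The two basis matrices differ in column \<open>i\<close> only, and this column is
  overwritten on both sides.\<close>

lemma tableau_insert_same:
  assumes "i < n"
  shows "tableau n a (insert i D) i k = tableau n a D i k"
proof -
  have "replace_col (basis_mat n a (insert i D)) (vec n (\<lambda>r. a r k)) i =
      replace_col (basis_mat n a D) (vec n (\<lambda>r. a r k)) i"
    using assms by (intro eq_matI) (auto simp: basis_mat_def replace_col_def)
  then show ?thesis by (simp add: tableau_def)
qed

text \<open>A column of the tableau is the adjugate of the basis matrix applied to column
  \<open>k\<close> of \<open>a\<close>, and a matrix times its adjugate is its determinant times the
  identity.\<close>

lemma basis_mat_tableau:
  assumes "r < n"
  shows "(\<Sum>c<n. basis_mat n a D $$ (r, c) * tableau n a D c k) = pivot_det n a D * a r k"
proof -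
  let ?B = "basis_mat n a D" and ?b = "vec n (\<lambda>r. a r k)"
  let ?v = "adj_mat ?B *\<^sub>v ?b"
  note adj = adj_mat[OF basis_mat_carrier[of n a D]]
  have v: "?v \<in> carrier_vec n" using adj(1) by (rule mult_mat_vec_carrier) simp
  have "?B *\<^sub>v ?v = (?B * adj_mat ?B) *\<^sub>v ?b"
    by (rule assoc_mult_mat_vec[symmetric, OF basis_mat_carrier adj(1)]) simp
  also have "\<dots> = pivot_det n a D \<cdot>\<^sub>v ?b"
    by (auto simp: adj(2) pivot_det_def intro!: eq_vecI)
  finally have "(?B *\<^sub>v ?v) $ r = pivot_det n a D * a r k"
    using assms by simp
  moreover have "(?B *\<^sub>v ?v) $ r = (\<Sum>c<n. ?B $$ (r, c) * ?v $ c)"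
    using assms v by (simp add: mult_mat_vec_index[OF basis_mat_carrier])
  ultimately show ?thesis
    by (simp add: tableau_def det_replace_col[of _ n])
qed

text \<open>
  The vector \<open>w\<close> below solves the linear system of the
  new basis matrix up to the factor \<open>pivot_det n a D * tableau n a D i i\<close>.
\<close>

lemma tableau_insert:
  assumes i: "i < n" "i \<notin> D" and j: "j < n" "j \<noteq> i" and pos: "tableau n a D i i \<noteq> 0"
  shows "tableau n a (insert i D) j k * pivot_det n a D =
    tableau n a D i i * tableau n a D j k - tableau n a D j i * tableau n a D i k"
proof -
  let ?B = "basis_mat n a D" and ?B' = "basis_mat n a (insert i D)"
  let ?d = "pivot_det n a D" and ?S = "tableau n a D"
  let ?b = "vec n (\<lambda>r. a r k)"
  define w where "w = vec n (\<lambda>c. if c = i then ?d * ?S i k else ?S i i * ?S c k - ?S c i * ?S i k)"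
  have B': "?B' $$ (r, c) = (if c = i then a r i else ?B $$ (r, c))" if "r < n" "c < n" for r c
    using that by (simp add: basis_mat_def)
  have Bw: "?B' *\<^sub>v w = (?d * ?S i i) \<cdot>\<^sub>v ?b"
  proof (rule eq_vecI)
    fix r assume "r < dim_vec ((?d * ?S i i) \<cdot>\<^sub>v ?b)"
    then have r: "r < n" by simp
    have split: "sum f {..<n} = f i + sum f ({..<n} - {i})" for f :: "nat \<Rightarrow> int"
      using i by (intro sum.remove) simp_all
    have "(?B' *\<^sub>v w) $ r = (\<Sum>c<n. ?B' $$ (r, c) * w $ c)"
      using r by (intro mult_mat_vec_index) (simp_all add: w_def)
    also have "\<dots> = a r i * (?d * ?S i k) +
        (\<Sum>c\<in>{..<n} - {i}. ?B $$ (r, c) * (?S i i * ?S c k - ?S c i * ?S i k))"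
      unfolding split using i r by (simp add: B' w_def)
    also have "(\<Sum>c\<in>{..<n} - {i}. ?B $$ (r, c) * (?S i i * ?S c k - ?S c i * ?S i k)) =
        ?S i i * (\<Sum>c\<in>{..<n} - {i}. ?B $$ (r, c) * ?S c k) -
        ?S i k * (\<Sum>c\<in>{..<n} - {i}. ?B $$ (r, c) * ?S c i)"
      by (simp add: sum_distrib_left sum_subtractf[symmetric] algebra_simps)
    also have "(\<Sum>c\<in>{..<n} - {i}. ?B $$ (r, c) * ?S c k) = ?d * a r k - ?B $$ (r, i) * ?S i k"
      using basis_mat_tableau[OF r, of a D k] unfolding split by simp
    also have "(\<Sum>c\<in>{..<n} - {i}. ?B $$ (r, c) * ?S c i) = ?d * a r i - ?B $$ (r, i) * ?S i i"
      using basis_mat_tableau[OF r, of a D i] unfolding split by simp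
    finally show "(?B' *\<^sub>v w) $ r = ((?d * ?S i i) \<cdot>\<^sub>v ?b) $ r"
      using r by (simp add: algebra_simps)
  qed (simp add: carrier_matD(1)[OF basis_mat_carrier])
  \<comment> \<open>Cramer's rule for \<open>?B'\<close>, whose determinant is
    \<open>?S i i\<close>. Cancelling this factor leaves \<open>?d\<close> as an exact divisor of
    the two-by-two minor \<open>w $ j\<close>.\<close>
  have "w $ j * ?S i i = w $ j * det ?B'"
    using i by (simp add: pivot_det_insert[symmetric] pivot_det_def)
  also have "\<dots> = det (replace_col ?B' ((?d * ?S i i) \<cdot>\<^sub>v ?b) j)"
    unfolding Bw[symmetric] by (rule cramer_lemma_mat[symmetric, of _ n]) (simp_all add: j w_def)
  also have "\<dots> = ?d * ?S i i * tableau n a (insert i D) j k"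
    unfolding tableau_def using j adj_mat(1)[OF basis_mat_carrier[of n a "insert i D"]]
    by (simp add: det_replace_col[of _ n])
  finally have "?S i i * w $ j = ?S i i * (tableau n a (insert i D) j k * ?d)"
    by (simp add: algebra_simps)
  then have "w $ j = tableau n a (insert i D) j k * ?d"
    using pos by simp
  then show ?thesis using i j by (simp add: w_def)
qed

text \<open>Leibniz formula with \<open>fact n\<close> products of \<open>n\<close> entries. This is
  cruder than Hadamard's bound, but its length is still polynomial.\<close>

lemma abs_det_le:
  fixes A :: "int mat"
  assumes A: "A \<in> carrier_mat n n" and h: "\<And>i j. i < n \<Longrightarrow> j < n \<Longrightarrow> \<bar>A $$ (i, j)\<bar> \<le> h"
  shows "\<bar>det A\<bar> \<le> fact n * h ^ n"
proof -
  let ?P = "{p. p permutes {0..<n}}"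
  have "\<bar>det A\<bar> \<le> (\<Sum>p\<in>?P. \<bar>signof p * (\<Prod>i = 0..<n. A $$ (i, p i))\<bar>)"
    unfolding det_def'[OF A] by (rule sum_abs)
  also have "\<dots> \<le> (\<Sum>p\<in>?P. h ^ n)"
  proof (rule sum_mono)
    fix p assume p: "p \<in> ?P"
    have "\<bar>\<Prod>i = 0..<n. A $$ (i, p i)\<bar> \<le> (\<Prod>i = 0..<n. h)"
      unfolding abs_prod using p h by (intro prod_mono) (auto dest: permutes_in_image)
    then show "\<bar>signof p * (\<Prod>i = 0..<n. A $$ (i, p i))\<bar> \<le> h ^ n"
      by (simp add: abs_mult sign_def)
  qed
  also have "\<dots> = fact n * h ^ n"
    using card_permutations[OF refl, of "{0..<n}"] by simp
  finally show ?thesis .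
qed

text \<open>The assumption \<open>1 \<le> h\<close> takes care of the unit columns of the basis
  matrix. The set \<open>D\<close> is arbitrary, so the bound covers every tableau that a run could
  meet.\<close>

lemma
  assumes h: "\<And>i j. i < n \<Longrightarrow> j \<le> n \<Longrightarrow> \<bar>a i j\<bar> \<le> h" and "1 \<le> h"
  shows abs_pivot_det_le: "\<bar>pivot_det n a D\<bar> \<le> fact n * h ^ n"
    and abs_tableau_le: "k \<le> n \<Longrightarrow> \<bar>tableau n a D c k\<bar> \<le> fact n * h ^ n"
  unfolding pivot_det_def tableau_def
  by (rule abs_det_le; use assms in \<open>auto simp: basis_mat_def replace_col_def\<close>)+

text \<open>Column \<open>n\<close> is the right hand side. The sign condition off the diagonal is
  the Z-property, and the comparison with the row sum says that the vector of ones stays feasible.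
  The last two clauses keep every index with \<open>a i i \<le> 0\<close> out of \<open>D\<close>;
  they serve the banks without debt.\<close>

definition pivot_invariant :: "nat \<Rightarrow> (nat \<Rightarrow> nat \<Rightarrow> int) \<Rightarrow> nat set \<Rightarrow> bool" where
  "pivot_invariant n a D \<longleftrightarrow> D \<subseteq> {..<n} \<and> 0 < pivot_det n a D \<and>
     (\<forall>i<n. \<forall>k<n. k \<noteq> i \<longrightarrow> tableau n a D i k \<le> 0) \<and>
     (\<forall>i<n. \<forall>k\<in>D. tableau n a D i k = (if k = i then pivot_det n a D else 0)) \<and>
     (\<forall>i<n. tableau n a D i n \<le> (\<Sum>k<n. tableau n a D i k)) \<and>
     (\<forall>i\<in>D. 0 \<le> tableau n a D i n) \<and>
     (\<forall>i<n. i \<notin> D \<longrightarrow> a i i \<le> 0 \<longrightarrow> tableau n a D i i \<le> 0) \<and>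
     (\<forall>i\<in>D. 0 < a i i)"

lemma pivot_invariant_empty:
  assumes "\<And>i k. i < n \<Longrightarrow> k < n \<Longrightarrow> k \<noteq> i \<Longrightarrow> a i k \<le> 0"
    and "\<And>i. i < n \<Longrightarrow> a i n \<le> (\<Sum>k<n. a i k)"
  shows "pivot_invariant n a {}"
  using assms by (auto simp: pivot_invariant_def tableau_empty)

text \<open>The row sum is at least the positive right hand side, and only the diagonal entry can
  contribute positively to it.\<close>

lemma pivot_invariant_pivot_pos:
  assumes inv: "pivot_invariant n a D" and i: "i < n" and pos: "0 < tableau n a D i n"
  shows "0 < tableau n a D i i"
proof -
  have "tableau n a D i n \<le> tableau n a D i i + (\<Sum>k\<in>{..<n} - {i}. tableau n a D i k)"
    using inv i by (simp add: pivot_invariant_def sum.remove[symmetric])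
  moreover have "(\<Sum>k\<in>{..<n} - {i}. tableau n a D i k) \<le> 0"
    using inv i by (intro sum_nonpos) (auto simp: pivot_invariant_def)
  ultimately show ?thesis using pos by linarith
qed

text \<open>Up to the positive factor \<open>?d\<close>, a row \<open>j\<close> other than
  \<open>i\<close> becomes \<open>?S i i\<close> times itself plus the nonnegative multiple
  \<open>- ?S j i\<close> of the pivot row. Hence the sign conditions and the row sum inequality
  carry over, and right hand sides in \<open>D\<close> stay nonnegative, so that no index has to
  leave \<open>D\<close>.\<close>

lemma pivot_invariant_insert:
  assumes inv: "pivot_invariant n a D" and i: "i < n" "i \<notin> D" and pos: "0 < tableau n a D i n"
  shows "pivot_invariant n a (insert i D)"
proof -
  let ?S = "tableau n a D" and ?S' = "tableau n a (insert i D)"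
  let ?d = "pivot_det n a D"
  from inv have D: "D \<subseteq> {..<n}" and d: "0 < ?d"
    and off: "\<And>i k. i < n \<Longrightarrow> k < n \<Longrightarrow> k \<noteq> i \<Longrightarrow> ?S i k \<le> 0"
    and unit: "\<And>i k. i < n \<Longrightarrow> k \<in> D \<Longrightarrow> ?S i k = (if k = i then ?d else 0)"
    and row: "\<And>i. i < n \<Longrightarrow> ?S i n \<le> (\<Sum>k<n. ?S i k)"
    and rhs: "\<And>i. i \<in> D \<Longrightarrow> 0 \<le> ?S i n"
    and diag: "\<And>i. i < n \<Longrightarrow> i \<notin> D \<Longrightarrow> a i i \<le> 0 \<Longrightarrow> ?S i i \<le> 0"
    and aD: "\<And>i. i \<in> D \<Longrightarrow> 0 < a i i"
    by (simp_all add: pivot_invariant_def)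
  have p: "0 < ?S i i" by (rule pivot_invariant_pivot_pos[OF inv i(1) pos])
  have same: "?S' i k = ?S i k" for k
    by (rule tableau_insert_same[OF i(1)])
  have step: "?S' j k * ?d = ?S i i * ?S j k - ?S j i * ?S i k" if "j < n" "j \<noteq> i" for j k
    using that p by (intro tableau_insert i) simp_all
  have nonpos: "x \<le> 0" if "x * ?d \<le> 0" for x
    using that d by (simp add: mult_le_0_iff)
  have nonneg: "0 \<le> x" if "0 \<le> x * ?d" for x
    using that d by (simp add: zero_le_mult_iff)
  show ?thesis
    unfolding pivot_invariant_def pivot_det_insert[OF i(1)]
  proof (intro conjI allI ballI impI)
    show "insert i D \<subseteq> {..<n}" using D i by simp
    show "0 < ?S i i" by (rule p)
  next
    fix j k assume jk: "j < n" "k < n" "k \<noteq> j"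
    show "?S' j k \<le> 0"
    proof (cases "j = i")
      case True then show ?thesis using off[OF jk] by (simp add: same)
    next
      case False
      show ?thesis
      proof (cases "k = i")
        case True
        then show ?thesis using step[OF jk(1) False, of k] d by simp
      next
        case k: False
        have "?S i i * ?S j k \<le> 0"
          using p off[OF jk] by (intro mult_nonneg_nonpos) simp_all
        moreover have "0 \<le> ?S j i * ?S i k"
          using off[OF jk(1) i(1)] off[OF i(1) jk(2) k] False by (intro mult_nonpos_nonpos) simp_all
        ultimately have "?S' j k * ?d \<le> 0"
          unfolding step[OF jk(1) False] by simp
        then show ?thesis by (rule nonpos)
      qed
    qed
  next
    fix j k assume jk: "j < n" "k \<in> insert i D"
    show "?S' j k = (if k = j then ?S i i else 0)"
    proof (cases "j = i")
      case True
      then show ?thesis using unit[OF i(1), of k] jk i by (cases "k = i") (auto simp: same)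
    next
      case False
      show ?thesis
      proof (cases "k = i")
        case True
        then show ?thesis using step[OF jk(1) False, of k] d False by simp
      next
        case k: False
        then have "?S' j k * ?d = ?S i i * (if k = j then ?d else 0)"
          using step[OF jk(1) False, of k] unit[OF jk(1), of k] unit[OF i(1), of k] jk by simp
        then show ?thesis using d by (cases "k = j") simp_all
      qed
    qed
  next
    fix j assume j: "j < n"
    show "?S' j n \<le> (\<Sum>k<n. ?S' j k)"
    proof (cases "j = i")
      case True then show ?thesis using row[OF i(1)] by (simp add: same)
    next
      case False
      \<comment> \<open>Times \<open>?d\<close>, the new gap between row sum and right hand side in
        row \<open>j\<close> is this combination of the old gaps in rows \<open>j\<close> and
        \<open>i\<close>.\<close>
      have "0 \<le> ?S i i * ((\<Sum>k<n. ?S j k) - ?S j n) - ?S j i * ((\<Sum>k<n. ?S i k) - ?S i n)"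
      proof -
        have "0 \<le> ?S i i * ((\<Sum>k<n. ?S j k) - ?S j n)"
          using p row[OF j] by (intro mult_nonneg_nonneg) simp_all
        moreover have "?S j i * ((\<Sum>k<n. ?S i k) - ?S i n) \<le> 0"
          using row[OF i(1)] off[OF j i(1)] False by (intro mult_nonpos_nonneg) simp_all
        ultimately show ?thesis by linarith
      qed
      also have "\<dots> = (\<Sum>k<n. ?S' j k * ?d) - ?S' j n * ?d"
        unfolding step[OF j False] sum_subtractf sum_distrib_left[symmetric]
        by (simp only: right_diff_distrib)
      also have "\<dots> = ((\<Sum>k<n. ?S' j k) - ?S' j n) * ?d"
        by (simp only: sum_distrib_right left_diff_distrib)
      finally have "0 \<le> (\<Sum>k<n. ?S' j k) - ?S' j n" by (rule nonneg)
      then show ?thesis by simp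
    qed
  next
    fix j assume j: "j \<in> insert i D"
    show "0 \<le> ?S' j n"
    proof (cases "j = i")
      case True then show ?thesis using pos same by simp
    next
      case False
      then have jD: "j \<in> D" "j < n" using j D by auto
      have "0 \<le> ?S i i * ?S j n"
        using p rhs[OF jD(1)] by simp
      moreover have "?S j i * ?S i n \<le> 0"
        using off[OF jD(2) i(1)] pos False by (intro mult_nonpos_nonneg) simp_all
      ultimately have "0 \<le> ?S' j n * ?d"
        unfolding step[OF jD(2) False] by simp
      then show ?thesis by (rule nonneg)
    qed
    show "0 < a j j"
    proof (cases "j = i")
      case True
      then show ?thesis using diag[OF i] p by (meson not_less)
    next
      case False
      then show ?thesis using j aD by simp
    qed
  next
    fix j assume j: "j < n" "j \<notin> insert i D" "a j j \<le> 0"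
    then have ji: "j \<noteq> i" "j \<notin> D" by simp_all
    have "?S i i * ?S j j \<le> 0"
      using p diag[OF j(1) ji(2) j(3)] by (intro mult_nonneg_nonpos) simp_all
    moreover have "0 \<le> ?S j i * ?S i j"
      using off[OF j(1) i(1)] off[OF i(1) j(1)] ji by (intro mult_nonpos_nonpos) simp_all
    ultimately have "?S' j j * ?d \<le> 0"
      unfolding step[OF j(1) ji(1)] by simp
    then show "?S' j j \<le> 0" by (rule nonpos)
  qed
qed

text \<open>The basic solution belonging to \<open>D\<close>, scaled by the common denominator
  \<open>pivot_det n a D\<close> to stay integral.\<close>

definition pivot_solution :: "nat \<Rightarrow> (nat \<Rightarrow> nat \<Rightarrow> int) \<Rightarrow> nat set \<Rightarrow> nat \<Rightarrow> int" where
  "pivot_solution n a D k = (if k \<in> D then tableau n a D k n else 0)"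

text \<open>For \<open>k \<in> D\<close> the diagonal entry is the determinant and the rest of row
  \<open>k\<close> is nonpositive, so the row sum inequality gives the upper bound. It will mean
  that recovery rates are nonnegative.\<close>

lemma pivot_solution_bounds:
  assumes inv: "pivot_invariant n a D"
  shows "0 \<le> pivot_solution n a D k" "pivot_solution n a D k \<le> pivot_det n a D"
proof -
  show "0 \<le> pivot_solution n a D k"
    using inv by (simp add: pivot_invariant_def pivot_solution_def)
  show "pivot_solution n a D k \<le> pivot_det n a D"
  proof (cases "k \<in> D")
    case True
    then have k: "k < n" using inv by (auto simp: pivot_invariant_def)
    have "tableau n a D k n \<le> tableau n a D k k + (\<Sum>l\<in>{..<n} - {k}. tableau n a D k l)"
      using inv k by (simp add: pivot_invariant_def sum.remove[symmetric])
    moreover have "(\<Sum>l\<in>{..<n} - {k}. tableau n a D k l) \<le> 0"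
      using inv k by (intro sum_nonpos) (auto simp: pivot_invariant_def)
    moreover have "tableau n a D k k = pivot_det n a D"
      using inv k True by (simp add: pivot_invariant_def)
    ultimately show ?thesis using True by (simp add: pivot_solution_def)
  next
    case False
    then show ?thesis using inv by (simp add: pivot_invariant_def pivot_solution_def)
  qed
qed

text \<open>Let \<open>B\<close> be the basis matrix, \<open>S\<close> the tableau and
  \<open>y\<close> the basic solution. Both \<open>B S\<close> and \<open>S y\<close> are known up
  to the determinant, namely as multiples of \<open>a\<close> and of \<open>y\<close>, so
  \<open>a y = B y\<close>. Moreover \<open>y\<close> differs from column \<open>n\<close> of
  \<open>S\<close> only outside \<open>D\<close>, where \<open>B\<close> has unit columns.
  Complementarity is built in: rows in \<open>D\<close> have no slack.\<close>

lemma pivot_solution_row: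
  assumes inv: "pivot_invariant n a D" and r: "r < n"
  shows "(\<Sum>k<n. a r k * pivot_solution n a D k) =
    pivot_det n a D * a r n - (if r \<in> D then 0 else tableau n a D r n)"
proof -
  let ?S = "tableau n a D" and ?d = "pivot_det n a D" and ?y = "pivot_solution n a D"
  let ?B = "\<lambda>c. basis_mat n a D $$ (r, c)"
  have Sy: "(\<Sum>k<n. ?S c k * ?y k) = ?d * ?y c" if "c < n" for c
  proof -
    have "?S c k * ?y k = (if k = c then ?d * ?y c else 0)" for k
      using inv that by (auto simp: pivot_invariant_def pivot_solution_def)
    then show ?thesis using that by simp
  qed
  have B: "?B c * (?S c n - ?y c) = (if c = r then (if r \<in> D then 0 else ?S r n) else 0)"
    if "c < n" for c
    using that r by (auto simp: basis_mat_def pivot_solution_def)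
  have "?d * (\<Sum>k<n. a r k * ?y k) = (\<Sum>k<n. (\<Sum>c<n. ?B c * ?S c k) * ?y k)"
    by (simp add: basis_mat_tableau[OF r] sum_distrib_left mult.assoc)
  also have "\<dots> = (\<Sum>c<n. ?B c * (\<Sum>k<n. ?S c k * ?y k))"
    unfolding sum_distrib_left sum_distrib_right mult.assoc by (rule sum.swap)
  also have "\<dots> = ?d * (\<Sum>c<n. ?B c * ?y c)"
    by (simp add: Sy sum_distrib_left mult.left_commute)
  finally have "(\<Sum>k<n. a r k * ?y k) = (\<Sum>c<n. ?B c * ?y c)"
    using inv by (simp add: pivot_invariant_def)
  moreover have "(\<Sum>c<n. ?B c * ?S c n) - (\<Sum>c<n. ?B c * ?y c) =
      (\<Sum>c<n. if c = r then (if r \<in> D then 0 else ?S r n) else 0)"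
    unfolding sum_subtractf[symmetric] right_diff_distrib[symmetric]
    by (intro sum.cong refl B) simp
  ultimately show ?thesis
    using r by (simp add: basis_mat_tableau[OF r])
qed

section \<open>Clearing as a linear complementarity problem\<close>

text \<open>The liabilities of \<open>d\<close> never exceed its total notional, hence
  \<open>ext N d\<close>, so rate 1 is correct for \<open>d\<close>. All other banks owe constant
  amounts, and with \<open>r d = 1\<close> all assets are affine in \<open>r\<close>;
  \<open>le\<close> and \<open>eq\<close> together express the minimum with 1.\<close>

lemma clearing_if_reduced:
  assumes fin: "financial_network N" and d: "central_cds_debtor N d"
    and r01: "\<And>i. i < nbanks N \<Longrightarrow> 0 \<le> r i \<and> r i \<le> 1"
    and r1: "\<And>i. i < nbanks N \<Longrightarrow> (\<Sum>j<nbanks N. debt N i j) = 0 \<Longrightarrow> r i = 1"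
    and le: "\<And>i. i < nbanks N \<Longrightarrow> (\<Sum>j<nbanks N. debt N i j) * r i \<le>
        ext N i + (\<Sum>k<nbanks N. debt N k i * r k) +
        (\<Sum>k<nbanks N. \<Sum>j<nbanks N. cds N j i k * (1 - r k))"
    and eq: "\<And>i. i < nbanks N \<Longrightarrow> r i \<noteq> 1 \<Longrightarrow> (\<Sum>j<nbanks N. debt N i j) * r i =
        ext N i + (\<Sum>k<nbanks N. debt N k i * r k) +
        (\<Sum>k<nbanks N. \<Sum>j<nbanks N. cds N j i k * (1 - r k))"
  shows "clearing N r"
proof -
  let ?n = "nbanks N"
  have dn: "d < ?n" using d by (simp add: central_cds_debtor_def)
  have cds0: "cds N i j k = 0" if "i < ?n" "j < ?n" "k < ?n" "i \<noteq> d" for i j k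
    using d that by (auto simp: central_cds_debtor_def is_cds_def)
  have debt0: "debt N d j = 0" if "j < ?n" for j
    using d that by (auto simp: central_cds_debtor_def is_debt_def)
  have ext0: "0 \<le> ext N i" if "i < ?n" for i using fin that by (simp add: financial_network_def)
  have cdsp: "0 \<le> cds N i j k" if "i < ?n" "j < ?n" "k < ?n" for i j k
    using fin that by (simp add: financial_network_def)
  have debtp: "0 \<le> debt N i j" if "i < ?n" "j < ?n" for i j
    using fin that by (simp add: financial_network_def)
  have rd: "r d = 1" using r1 dn debt0 by simp
  have liab: "liability N r i = (\<Sum>j<?n. debt N i j)" if "i < ?n" "i \<noteq> d" for i
    using that cds0 by (simp add: liability_def liability_to_def)
  have assets: "assets N r i = ext N i + (\<Sum>k<?n. debt N k i * r k) +
      (\<Sum>k<?n. \<Sum>j<?n. cds N j i k * (1 - r k))" if i: "i < ?n" for i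
  proof -
    have "payment N r j i = debt N j i * r j + (\<Sum>k<?n. cds N j i k * (1 - r k))" if j: "j < ?n" for j
    proof -
      \<comment> \<open>The product \<open>r j * (1 - r k)\<close> loses its first factor: only
        \<open>j = d\<close> has a nonzero notional, and \<open>r d = 1\<close>.\<close>
      have "(\<Sum>k<?n. r j * ((1 - r k) * cds N j i k)) = (\<Sum>k<?n. cds N j i k * (1 - r k))"
      proof (rule sum.cong)
        fix k assume "k \<in> {..<?n}"
        then show "r j * ((1 - r k) * cds N j i k) = cds N j i k * (1 - r k)"
          using cds0[OF j i, of k] rd by (cases "j = d") simp_all
      qed simp
      then show ?thesis
        by (simp add: payment_def liability_to_def distrib_left sum_distrib_left mult.commute)
    qed
    then have "assets N r i = ext N i + (\<Sum>k<?n. debt N k i * r k) +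
        (\<Sum>j<?n. \<Sum>k<?n. cds N j i k * (1 - r k))"
      by (simp add: assets_def sum.distrib)
    then show ?thesis by (subst sum.swap) simp
  qed
  have liabd: "liability N r d \<le> assets N r d"
  proof -
    have "liability N r d = (\<Sum>j<?n. \<Sum>k<?n. (1 - r k) * cds N d j k)"
      using debt0 by (simp add: liability_def liability_to_def)
    also have "\<dots> \<le> (\<Sum>j<?n. \<Sum>k<?n. cds N d j k)"
      using r01 cdsp dn by (intro sum_mono mult_left_le_one_le) auto
    also have "\<dots> \<le> ext N d" using d by (simp add: central_cds_debtor_def)
    also have "\<dots> \<le> assets N r d"
      unfolding assets[OF dn] using r01 cdsp debtp dn
      by (auto intro!: sum_nonneg mult_nonneg_nonneg add_nonneg_nonneg)
    finally show ?thesis .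
  qed
  show ?thesis
    unfolding clearing_def
  proof (intro allI impI conjI)
    fix i assume i: "i < ?n"
    show "0 \<le> r i" "r i \<le> 1" using r01[OF i] by simp_all
    show "r i = 1" if "liability N r i = 0"
      using that i rd r1 liab by (cases "i = d") auto
    assume pos: "0 < liability N r i"
    show "r i = min 1 (assets N r i / liability N r i)"
    proof (cases "i = d")
      case True
      then show ?thesis using liabd pos rd by simp
    next
      case False
      note L = liab[OF i False]
      show ?thesis
      proof (cases "r i = 1")
        case True
        then have "liability N r i \<le> assets N r i"
          using le[OF i] unfolding assets[OF i] L by simp
        then show ?thesis using True pos by simp
      next
        case r: False
        then have "liability N r i * r i = assets N r i"
          using eq[OF i] unfolding assets[OF i] L by simp
        then have "r i = assets N r i / liability N r i"
          using pos by (metis less_irrefl nonzero_mult_div_cancel_left)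
        then show ?thesis using r01[OF i] by (simp add: min_absorb2)
      qed
    qed
  qed
qed

text \<open>
  The linear system for the deficits \<open>1 - r i\<close>, multiplied by a common denominator \<open>g\<close>.  In its
  right hand side, column \<open>nbanks N\<close>, the credit default swaps cancel, because none of them pays
  when all banks are solvent.
\<close>

definition deficit_matrix :: "network \<Rightarrow> int \<Rightarrow> (nat \<Rightarrow> nat \<Rightarrow> int) \<Rightarrow> bool" where
  "deficit_matrix N g a \<longleftrightarrow> (\<forall>i<nbanks N.
     of_int (a i (nbanks N)) = of_int g *
       ((\<Sum>j<nbanks N. debt N i j) - (\<Sum>j<nbanks N. debt N j i) - ext N i) \<and>
     (\<forall>k<nbanks N. of_int (a i k) = of_int g *
       ((if k = i then \<Sum>j<nbanks N. debt N i j else 0) - debt N k i + (\<Sum>j<nbanks N. cds N j i k))))"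

text \<open>Off the diagonal an entry is a swap notional minus the debt of the reference bank to the
  same creditor, which coverage makes nonpositive; for a bank without debt the diagonal entry has
  this form too. The row sum exceeds the right hand side by \<open>g\<close> times the external
  assets and the swap notionals owed to bank \<open>i\<close>.\<close>

lemma
  assumes fin: "financial_network N" and d: "central_cds_debtor N d" and cov: "all_cds_covered N"
    and g: "0 < g" and a: "deficit_matrix N g a"
  shows deficit_matrix_off_diagonal:
      "i < nbanks N \<Longrightarrow> k < nbanks N \<Longrightarrow> (\<Sum>j<nbanks N. debt N i j) = 0 \<or> k \<noteq> i \<Longrightarrow> a i k \<le> 0" (is "?i \<Longrightarrow> ?k \<Longrightarrow> ?o \<Longrightarrow> _")
    and deficit_matrix_row_sum: "i < nbanks N \<Longrightarrow> a i (nbanks N) \<le> (\<Sum>k<nbanks N. a i k)"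
proof -
  let ?n = "nbanks N"
  have cds0: "cds N i j k = 0" if "i < ?n" "j < ?n" "k < ?n" "i \<noteq> d" for i j k
    using d that by (auto simp: central_cds_debtor_def is_cds_def)
  have dn: "d < ?n" using d by (simp add: central_cds_debtor_def)
  {
    assume ik: ?i ?k ?o
    have "(\<Sum>j<?n. cds N j i k) = (\<Sum>j<?n. if j = d then cds N d i k else 0)"
      using cds0 ik by (intro sum.cong) auto
    also have "\<dots> = cds N d i k" using dn by simp
    also have "\<dots> \<le> debt N k i"
    proof (cases "is_cds N d i k")
      case True
      then show ?thesis using cov by (auto simp: all_cds_covered_def covered_def)
    next
      case False
      then show ?thesis using fin ik dn by (auto simp: is_cds_def financial_network_def)
    qed
    finally have "of_int (a i k) \<le> (0 :: rat)"
      using a g ik by (auto simp: deficit_matrix_def mult_le_0_iff)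
    then show "a i k \<le> 0" by simp
  }
  {
    assume i: ?i
    have "of_int (\<Sum>k<?n. a i k) = (\<Sum>k<?n. of_int g *
       ((if k = i then \<Sum>j<nbanks N. debt N i j else 0) - debt N k i + (\<Sum>j<nbanks N. cds N j i k)))"
      using a i by (simp add: deficit_matrix_def)
    also have "\<dots> = of_int g * (\<Sum>k<?n. (if k = i then \<Sum>j<nbanks N. debt N i j else 0) -
       debt N k i + (\<Sum>j<nbanks N. cds N j i k))"
      by (rule sum_distrib_left[symmetric])
    also have "\<dots> = of_int g * ((\<Sum>j<?n. debt N i j) - (\<Sum>j<?n. debt N j i) + (\<Sum>k<?n. \<Sum>j<?n. cds N j i k))"
      using i by (simp add: sum.distrib sum_subtractf)
    also have "\<dots> \<ge> of_int g * ((\<Sum>j<?n. debt N i j) - (\<Sum>j<?n. debt N j i) - ext N i)"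
    proof -
      have "0 \<le> (\<Sum>k<?n. \<Sum>j<?n. cds N j i k)" "0 \<le> ext N i"
        using fin i by (auto intro!: sum_nonneg simp: financial_network_def)
      then show ?thesis using g by (intro mult_left_mono) auto
    qed
    finally have "(of_int (a i ?n) :: rat) \<le> of_int (\<Sum>k<?n. a i k)"
      using a i by (simp add: deficit_matrix_def)
    then show "a i ?n \<le> (\<Sum>k<?n. a i k)" by (simp only: of_int_le_iff)
  }
qed

lemma clearing_pivot_solution:
  assumes fin: "financial_network N" and d: "central_cds_debtor N d" and cov: "all_cds_covered N"
    and g: "0 < g" and a: "deficit_matrix N g a"
    and inv: "pivot_invariant (nbanks N) a D"
    and final: "\<And>i. i < nbanks N \<Longrightarrow> i \<notin> D \<Longrightarrow> tableau (nbanks N) a D i (nbanks N) \<le> 0"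
    and r: "\<And>i. i < nbanks N \<Longrightarrow> r i = of_int (pivot_det (nbanks N) a D -
        pivot_solution (nbanks N) a D i) / of_int (pivot_det (nbanks N) a D)"
  shows "clearing N r"
proof -
  let ?n = "nbanks N"
  let ?\<Delta> = "pivot_det ?n a D" and ?y = "pivot_solution ?n a D"
  let ?\<delta> = "of_int ?\<Delta> :: rat"
  let ?L = "\<lambda>i. \<Sum>j<?n. debt N i j"
  have \<Delta>: "0 < ?\<Delta>" using inv by (simp add: pivot_invariant_def)
  have y: "of_int (?y i) = ?\<delta> * (1 - r i)" if "i < ?n" for i
    using r[OF that] \<Delta> by (simp add: field_simps)
  have distr: "x * (l - b + c) * (z * (1 - q)) = x * z * (l * (1 - q) - (b - b * q) + c * (1 - q))"
    for x l b c z q :: rat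
    by (simp add: algebra_simps)
  \<comment> \<open>In terms of \<open>r\<close>, the slack of row \<open>i\<close> is the assets of
    bank \<open>i\<close> minus its payments, times the positive factors \<open>g\<close> and the
    pivot determinant.\<close>
  have slack: "of_int (if i \<in> D then 0 else - tableau ?n a D i ?n) = of_int g * ?\<delta> *
      (ext N i + (\<Sum>k<?n. debt N k i * r k) + (\<Sum>k<?n. \<Sum>j<?n. cds N j i k * (1 - r k)) - ?L i * r i)"
    if i: "i < ?n" for i
  proof -
    have "(if i \<in> D then 0 else - tableau ?n a D i ?n) = (\<Sum>k<?n. a i k * ?y k) - ?\<Delta> * a i ?n"
      using pivot_solution_row[OF inv i] by simp
    then have "of_int (if i \<in> D then 0 else - tableau ?n a D i ?n) =
        (\<Sum>k<?n. of_int (a i k) * of_int (?y k)) - ?\<delta> * of_int (a i ?n)"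
      by (simp only: of_int_diff of_int_sum of_int_mult)
    also have "(\<Sum>k<?n. of_int (a i k) * of_int (?y k)) = (\<Sum>k<?n. of_int g * ?\<delta> *
        ((if k = i then ?L i * (1 - r i) else 0) - (debt N k i - debt N k i * r k) + (\<Sum>j<?n. cds N j i k * (1 - r k))))"
    proof (rule sum.cong)
      fix k assume "k \<in> {..<?n}"
      then have k: "k < ?n" by simp
      have "of_int (a i k) * of_int (?y k) = of_int g *
          ((if k = i then ?L i else 0) - debt N k i + (\<Sum>j<?n. cds N j i k)) * (?\<delta> * (1 - r k))"
        using a i k y[OF k] by (simp only: deficit_matrix_def)
      also have "\<dots> = of_int g * ?\<delta> * ((if k = i then ?L i * (1 - r i) else 0) -
          (debt N k i - debt N k i * r k) + (\<Sum>j<?n. cds N j i k) * (1 - r k))"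
        by (cases "k = i") (simp_all only: distr if_True if_False mult_zero_left simp_thms)
      finally show "of_int (a i k) * of_int (?y k) = of_int g * ?\<delta> *
          ((if k = i then ?L i * (1 - r i) else 0) - (debt N k i - debt N k i * r k) +
            (\<Sum>j<?n. cds N j i k * (1 - r k)))"
        by (simp only: sum_distrib_right)
    qed simp
    also have "\<dots> = of_int g * ?\<delta> * (?L i * (1 - r i) - ((\<Sum>k<?n. debt N k i) - (\<Sum>k<?n. debt N k i * r k)) +
        (\<Sum>k<?n. \<Sum>j<?n. cds N j i k * (1 - r k)))"
      using i unfolding sum_distrib_left[symmetric] by (simp add: sum.distrib sum_subtractf)
    also have "of_int (a i ?n) = of_int g * (?L i - (\<Sum>j<?n. debt N j i) - ext N i)"
      using a i by (simp add: deficit_matrix_def)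
    finally show ?thesis by (simp add: algebra_simps)
  qed
  have g\<Delta>: "0 < of_int g * ?\<delta>" using g \<Delta> by simp
  show ?thesis
  proof (rule clearing_if_reduced[OF fin d])
    fix i assume i: "i < ?n"
    show "0 \<le> r i \<and> r i \<le> 1"
      using pivot_solution_bounds[OF inv, of i] \<Delta> r[OF i] by simp
    \<comment> \<open>The diagonal entry of a bank without debt is nonpositive, so the invariant
      excludes it from \<open>D\<close> and its deficit is 0.\<close>
    show "r i = 1" if "?L i = 0"
    proof -
      have "a i i \<le> 0" using deficit_matrix_off_diagonal[OF fin d cov g a i i] that by simp
      then have "i \<notin> D" using inv by (force simp: pivot_invariant_def)
      then show ?thesis using r[OF i] \<Delta> by (simp add: pivot_solution_def)
    qed
    let ?s = "ext N i + (\<Sum>k<?n. debt N k i * r k) + (\<Sum>k<?n. \<Sum>j<?n. cds N j i k * (1 - r k)) - ?L i * r i"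
    have "0 \<le> of_int g * ?\<delta> * ?s"
      unfolding slack[OF i, symmetric] using final[OF i] by simp
    then have "0 \<le> ?s" by (rule mult_left_le_imp_le[OF _ g\<Delta>, of 0, simplified mult_zero_right])
    then show "?L i * r i \<le> ext N i + (\<Sum>k<?n. debt N k i * r k) + (\<Sum>k<?n. \<Sum>j<?n. cds N j i k * (1 - r k))"
      by simp
    assume "r i \<noteq> 1"
    moreover have "r i = 1" if "i \<notin> D"
      using r[OF i] \<Delta> that by (simp add: pivot_solution_def)
    ultimately have "i \<in> D" by blast
    then have "of_int g * ?\<delta> * ?s = 0"
      unfolding slack[OF i, symmetric] by simp
    then have "?s = 0" using g\<Delta> mult_eq_0_iff[of "of_int g * ?\<delta>" ?s] by linarith
    then show "?L i * r i = ext N i + (\<Sum>k<?n. debt N k i * r k) + (\<Sum>k<?n. \<Sum>j<?n. cds N j i k * (1 - r k))"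
      by simp
  qed
qed

section \<open>Matrix programs\<close>

lemma index_less: "i < n \<Longrightarrow> j < m \<Longrightarrow> i * m + j < n * m" for i j n m :: nat
proof -
  assume "i < n" "j < m"
  then have "i * m + j < Suc i * m" by simp
  also have "\<dots> \<le> n * m" using \<open>i < n\<close> by (intro mult_le_mono1) simp
  finally show ?thesis .
qed

lemma length_concat_uniform:
  "(\<And>i. i < n \<Longrightarrow> length (f i) = m) \<Longrightarrow> length (concat (map f [0..<n])) = n * m"
  by (induction n) simp_all

lemma nth_concat_uniform:
  assumes "\<And>i. i < n \<Longrightarrow> length (f i) = m" and "i < n" and "j < m"
  shows "concat (map f [0..<n]) ! (i * m + j) = f i ! j"
  using assms
proof (induction n)
  case (Suc n)
  have len: "length (concat (map f [0..<n])) = n * m"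
    by (rule length_concat_uniform) (simp add: Suc.prems)
  show ?case
  proof (cases "i = n")
    case True
    then show ?thesis using len by (simp add: nth_append)
  next
    case False
    then have i: "i < n" using Suc.prems by simp
    then show ?thesis using Suc len index_less[OF i Suc.prems(3)] by (simp add: nth_append)
  qed
qed simp

lemma int_size_of_nat: "int_size (int k) \<le> Suc k"
  unfolding int_size_le_iff using of_nat_less_two_power[of k, where 'a = int] by simp

section \<open>Counting loops and array updates\<close>

abbreviation Var :: "vname \<Rightarrow> aexp" where
  "Var x \<equiv> Read x (Const 0)"

abbreviation Assign :: "vname \<Rightarrow> aexp \<Rightarrow> com" where
  "Assign x e \<equiv> Write x (Const 0) e"

definition For :: "vname \<Rightarrow> aexp \<Rightarrow> com \<Rightarrow> com" where
  "For x e c = Seq (Assign x (Const 0))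
     (Loop (Less (Var x) e) (Seq c (Assign x (Add (Var x) (Const 1)))))"

text \<open>The invariant is demanded after the increment, so it may mention the counter. The strict
  \<open>N < w\<close> leaves room for the final counter value \<open>N\<close>, whose length is
  bounded by \<open>Suc N\<close>.\<close>

lemma achieves_For:
  assumes init: "I 0 (store s x 0 0)" and N: "N < w"
    and bound: "\<And>k s. I k s \<Longrightarrow> aval e s = int N"
    and body: "\<And>k s. k < N \<Longrightarrow> I k s \<Longrightarrow> s x 0 = int k \<Longrightarrow>
      achieves w c (\<lambda>s'. s' x 0 = int k \<and> I (Suc k) (store s' x 0 (int (Suc k)))) s"
    and Q: "\<And>s. I N s \<Longrightarrow> s x 0 = int N \<Longrightarrow> Q s"
  shows "achieves w (For x e c) Q s"
  unfolding For_def
proof (intro achieves_Seq achieves_Write)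
  show "int_size (aval (Const 0) s) \<le> w"
    using int_size_of_nat[of 0] N by simp
  let ?J = "\<lambda>k s. k \<le> N \<and> s x 0 = int k \<and> I k s"
  show "achieves w (Loop (Less (Var x) e) (Seq c (Assign x (Add (Var x) (Const 1))))) Q
     (store s x (aval (Const 0) s) (aval (Const 0) s))"
  proof (rule achieves_Loop[where I = "\<lambda>s. \<exists>k. ?J k s" and m = "\<lambda>s. N - nat (s x 0)"])
    show "\<exists>k. ?J k (store s x (aval (Const 0) s) (aval (Const 0) s))"
      using init by (intro exI[of _ 0]) simp
  next
    fix s assume "\<exists>k. ?J k s" and b: "bval (Less (Var x) e) s"
    then obtain k where k: "s x 0 = int k" "I k s" by blast
    then have "k < N" using b bound by simp
    show "achieves w (Seq c (Assign x (Add (Var x) (Const 1))))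
        (\<lambda>s'. (\<exists>k. ?J k s') \<and> N - nat (s' x 0) < N - nat (s x 0)) s"
    proof (rule achieves_Seq, rule achieves_mono[OF body[OF \<open>k < N\<close> k(2,1)]], elim conjE, rule achieves_Write)
      fix s' assume s': "s' x 0 = int k" "I (Suc k) (store s' x 0 (int (Suc k)))"
      then show "int_size (aval (Add (Var x) (Const 1)) s') \<le> w"
        using int_size_of_nat[of "Suc k"] N \<open>k < N\<close> by (simp add: add.commute)
      show "(\<exists>l. ?J l (store s' x (aval (Const 0) s') (aval (Add (Var x) (Const 1)) s'))) \<and>
          N - nat (store s' x (aval (Const 0) s') (aval (Add (Var x) (Const 1)) s') x 0) < N - nat (s x 0)"
        using s' k(1) \<open>k < N\<close> by (auto intro!: exI[of _ "Suc k"] simp: add.commute)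
    qed
  next
    fix s assume "\<exists>k. ?J k s" and b: "\<not> bval (Less (Var x) e) s"
    then show "Q s" using bound Q by force
  qed (use N in simp)
qed

text \<open>Array contents after the first \<open>k\<close> writes of \<open>\<epsilon> l\<close> to
  address \<open>\<alpha> l\<close>. A loop around a single assignment thereby gets an explicit
  final state instead of an invariant.\<close>

primrec scatter :: "(int \<Rightarrow> int) \<Rightarrow> (nat \<Rightarrow> int) \<Rightarrow> (nat \<Rightarrow> int) \<Rightarrow> nat \<Rightarrow> int \<Rightarrow> int" where
  "scatter f \<alpha> \<epsilon> 0 = f"
| "scatter f \<alpha> \<epsilon> (Suc k) = (scatter f \<alpha> \<epsilon> k)(\<alpha> k := \<epsilon> k)"

lemma scatter_outside: "i \<notin> \<alpha> ` {..<k} \<Longrightarrow> scatter f \<alpha> \<epsilon> k i = f i"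
  by (induction k) (auto simp: lessThan_Suc)

lemma scatter_inside: "inj \<alpha> \<Longrightarrow> l < k \<Longrightarrow> scatter f \<alpha> \<epsilon> k (\<alpha> l) = \<epsilon> l"
  by (induction k) (auto simp: less_Suc_eq inj_eq)

lemma scatter_int: "scatter f int \<epsilon> k (int l) = (if l < k then \<epsilon> l else f (int l))"
proof (cases "l < k")
  case False
  then have "int l \<notin> int ` {..<k}" by auto
  then show ?thesis using False by (simp add: scatter_outside)
qed (simp add: scatter_inside)

abbreviation filled :: "state \<Rightarrow> vname \<Rightarrow> vname \<Rightarrow> (nat \<Rightarrow> int) \<Rightarrow> (nat \<Rightarrow> int) \<Rightarrow> nat \<Rightarrow> state" where
  "filled s x X \<alpha> \<epsilon> k \<equiv> s(x := (s x)(0 := int k), X := scatter (s X) \<alpha> \<epsilon> k)"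

text \<open>Bound, address and value are evaluated in the intermediate state, so the loop may read
  the array that it is writing.\<close>

lemma achieves_For_Write:
  assumes "X \<noteq> x" and "N < w"
    and "\<And>k. aval e (filled s x X \<alpha> \<epsilon> k) = int N"
    and "\<And>k. k < N \<Longrightarrow> aval a (filled s x X \<alpha> \<epsilon> k) = \<alpha> k"
    and "\<And>k. k < N \<Longrightarrow> aval b (filled s x X \<alpha> \<epsilon> k) = \<epsilon> k"
    and "\<And>k. k < N \<Longrightarrow> int_size (\<epsilon> k) \<le> w"
    and "Q (filled s x X \<alpha> \<epsilon> N)"
  shows "achieves w (For x e (Write X a b)) Q s"
proof (rule achieves_For[where I = "\<lambda>k s'. s' = filled s x X \<alpha> \<epsilon> k" and N = N])
  show "store s x 0 0 = filled s x X \<alpha> \<epsilon> 0"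
    using assms(1) by (simp add: fun_eq_iff)
next
  fix k s' assume k: "k < N" and s': "s' = filled s x X \<alpha> \<epsilon> k"
  show "achieves w (Write X a b)
      (\<lambda>s'. s' x 0 = int k \<and> store s' x 0 (int (Suc k)) = filled s x X \<alpha> \<epsilon> (Suc k)) s'"
    unfolding s' using assms(1) assms(4-6)[OF k]
    by (intro achieves_Write) (auto simp: fun_eq_iff)
qed (use assms in simp_all)

text \<open>For integers, \<open>1 div (1 + x * x)\<close> is \<open>1\<close> if \<open>x = 0\<close> and \<open>0\<close> otherwise.\<close>

definition Equal :: "aexp \<Rightarrow> aexp \<Rightarrow> aexp" where
  "Equal a b = Quo (Const 1) (Add (Const 1) (Mul (Sub a b) (Sub a b)))"

lemma aval_Equal [simp]: "aval (Equal a b) s = of_bool (aval a s = aval b s)"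
proof (cases "aval a s = aval b s")
  case False
  then have "0 < (aval a s - aval b s) * (aval a s - aval b s)"
    by (auto simp: zero_less_mult_iff)
  then show ?thesis using False by (simp add: Equal_def)
qed (simp add: Equal_def)

text \<open>The loops over a matrix with \<open>m\<close> columns, stored row by row, use a single counter \<open>q\<close>.\<close>

definition row_of :: aexp where "row_of = Quo (Var ''q'') (Var ''m'')"
definition col_of :: aexp where "col_of = Sub (Var ''q'') (Mul row_of (Var ''m''))"
definition cell :: "vname \<Rightarrow> aexp \<Rightarrow> aexp \<Rightarrow> aexp" where
  "cell X a b = Read X (Add (Mul a (Var ''m'')) b)"

lemma aval_row_of: "s ''q'' 0 = int q \<Longrightarrow> s ''m'' 0 = int m \<Longrightarrow> aval row_of s = int (q div m)"
  by (simp add: row_of_def zdiv_int)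

lemma aval_col_of: "s ''q'' 0 = int q \<Longrightarrow> s ''m'' 0 = int m \<Longrightarrow> aval col_of s = int (q mod m)"
  by (simp add: col_of_def aval_row_of minus_div_mult_eq_mod[symmetric] zmod_int zdiv_int)

lemma aval_cell: "aval a s = int i \<Longrightarrow> aval b s = int k \<Longrightarrow> s ''m'' 0 = int m \<Longrightarrow>
    aval (cell X a b) s = s X (int (i * m + k))"
  by (simp add: cell_def)

definition holds_matrix :: "nat \<Rightarrow> state \<Rightarrow> vname \<Rightarrow> (nat \<Rightarrow> nat \<Rightarrow> int) \<Rightarrow> bool" where
  "holds_matrix n s X a \<longleftrightarrow> (\<forall>i<n. \<forall>k\<le>n. s X (int (i * Suc n + k)) = a i k)"

lemma matrix_index:
  assumes "q < n * Suc n"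
  shows "q div Suc n < n" "q mod Suc n \<le> n" "q div Suc n * Suc n + q mod Suc n = q"
  using assms by (auto simp: less_mult_imp_div_less less_Suc_eq_le[symmetric] simp del: mult_Suc_right)

lemma holds_matrix_iff: "holds_matrix n s X a \<longleftrightarrow> (\<forall>q<n * Suc n. s X (int q) = a (q div Suc n) (q mod Suc n))"
proof
  assume "holds_matrix n s X a"
  then show "\<forall>q<n * Suc n. s X (int q) = a (q div Suc n) (q mod Suc n)"
    unfolding holds_matrix_def by (metis matrix_index)
next
  assume *: "\<forall>q<n * Suc n. s X (int q) = a (q div Suc n) (q mod Suc n)"
  show "holds_matrix n s X a"
    unfolding holds_matrix_def
  proof (intro allI impI)
    fix i k assume ik: "i < n" "k \<le> n"
    have "i * Suc n + k < Suc i * Suc n" using ik by simp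
    also have "\<dots> \<le> n * Suc n" using ik by (intro mult_le_mono1) simp
    finally have "s X (int (i * Suc n + k)) = a ((i * Suc n + k) div Suc n) ((i * Suc n + k) mod Suc n)"
      using * by blast
    moreover have "(i * Suc n + k) div Suc n = i" "(i * Suc n + k) mod Suc n = k"
      using ik by (simp_all only: div_mult_self3 mod_mult_self3 div_less mod_less less_Suc_eq_le)
    ultimately show "s X (int (i * Suc n + k)) = a i k" by simp
  qed
qed

section \<open>The program\<close>

text \<open>In the pivot row the first summand vanishes; the second one restores the row.\<close>

definition eliminate_com :: com where
  "eliminate_com = For ''q'' (Mul (Var ''n'') (Var ''m'')) (Write ''T'' (Var ''q'')
     (Add (Quo (Sub (Mul (cell ''S'' (Var ''i'') (Var ''i'')) (cell ''S'' row_of col_of))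
                    (Mul (cell ''S'' row_of (Var ''i'')) (cell ''S'' (Var ''i'') col_of)))
               (Var ''p''))
          (Mul (Equal row_of (Var ''i'')) (cell ''S'' (Var ''i'') col_of))))"

text \<open>Elimination builds the new tableau in \<open>T\<close> because every new entry needs the
  old pivot row and the old pivot column.\<close>

definition copy_com :: com where
  "copy_com = For ''q'' (Mul (Var ''n'') (Var ''m''))
     (Write ''S'' (Var ''q'') (Read ''T'' (Var ''q'')))"

text \<open>Elimination leaves the pivot entry unchanged; it is the new determinant and hence the
  divisor \<open>p\<close> of the next step. The scan restarts at bank 0 because the new default can
  make the right hand side of an earlier row positive.\<close>

definition pivot_com :: com where
  "pivot_com = Seq eliminate_com (Seq copy_com
    (Seq (Assign ''p'' (cell ''S'' (Var ''i'') (Var ''i'')))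
    (Seq (Write ''d'' (Var ''i'') (Const 1))
         (Assign ''i'' (Const 0)))))"

definition solve_com :: com where
  "solve_com = Seq (Assign ''i'' (Const 0)) (Loop (Less (Var ''i'') (Var ''n''))
     (Cond (Conj (Less (Read ''d'' (Var ''i'')) (Const 1))
                 (Less (Const 0) (cell ''S'' (Var ''i'') (Var ''n''))))
        pivot_com
        (Assign ''i'' (Add (Var ''i'') (Const 1)))))"

definition holds_tableau :: "nat \<Rightarrow> (nat \<Rightarrow> nat \<Rightarrow> int) \<Rightarrow> nat set \<Rightarrow> state \<Rightarrow> bool" where
  "holds_tableau n a D s \<longleftrightarrow> s ''n'' 0 = int n \<and> s ''m'' 0 = int (Suc n) \<and>
     pivot_invariant n a D \<and> holds_matrix n s ''S'' (tableau n a D) \<and>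
     s ''p'' 0 = pivot_det n a D \<and> (\<forall>i<n. s ''d'' (int i) = of_bool (i \<in> D))"

lemma achieves_pivot:
  assumes s: "holds_tableau n a D s" and r: "s ''i'' 0 = int r" "r < n" "r \<notin> D"
    and pos: "0 < tableau n a D r n"
    and w: "n * Suc n < w" "\<And>i k D. k \<le> n \<Longrightarrow> int_size (tableau n a D i k) \<le> w"
  shows "achieves w pivot_com (\<lambda>s'. holds_tableau n a (insert r D) s' \<and> s' ''i'' 0 = 0) s"
proof -
  let ?S = "tableau n a D" and ?S' = "tableau n a (insert r D)"
  let ?\<epsilon> = "\<lambda>q. ?S' (q div Suc n) (q mod Suc n)"
  let ?s1 = "filled s ''q'' ''T'' int ?\<epsilon> (n * Suc n)"
  let ?s2 = "filled ?s1 ''q'' ''S'' int ?\<epsilon> (n * Suc n)"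
  from s have n: "s ''n'' 0 = int n" and m: "s ''m'' 0 = int (Suc n)"
    and inv: "pivot_invariant n a D" and p: "s ''p'' 0 = pivot_det n a D"
    and S: "\<And>i k. i < n \<Longrightarrow> k \<le> n \<Longrightarrow> s ''S'' (int (i * Suc n + k)) = ?S i k"
    and d: "\<And>i. i < n \<Longrightarrow> s ''d'' (int i) = of_bool (i \<in> D)"
    by (simp_all add: holds_tableau_def holds_matrix_def)
  have \<Delta>: "0 < pivot_det n a D" using inv by (simp add: pivot_invariant_def)
  have rr: "0 < ?S r r" by (rule pivot_invariant_pivot_pos[OF inv r(2) pos])
  have inv': "pivot_invariant n a (insert r D)" by (rule pivot_invariant_insert[OF inv r(2,3) pos])
  have w1: "int_size 1 \<le> w" "int_size 0 \<le> w"
    using int_size_of_nat[of 1] int_size_of_nat[of 0] r(2) w(1) by (cases n; simp)+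
  \<comment> \<open>By \<open>tableau_insert\<close> the previous determinant divides the numerator,
    so \<open>div\<close> loses nothing.\<close>
  have new: "(?S r r * ?S j k - ?S j r * ?S r k) div pivot_det n a D + of_bool (j = r) * ?S r k = ?S' j k"
    if "j < n" for j k
  proof (cases "j = r")
    case True then show ?thesis by (simp add: tableau_insert_same[OF r(2)])
  next
    case False
    then have "?S r r * ?S j k - ?S j r * ?S r k = ?S' j k * pivot_det n a D"
      using rr by (subst tableau_insert[OF r(2,3) that]) simp_all
    then show ?thesis using False \<Delta> by simp
  qed
  have S2: "holds_matrix n s' ''S'' ?S'" if "s' ''S'' = ?s2 ''S''" for s'
    unfolding holds_matrix_iff that by (simp add: scatter_int)
  have eliminate: "achieves w eliminate_com (\<lambda>s'. s' = ?s1) s"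
    unfolding eliminate_com_def
  proof (rule achieves_For_Write[where \<alpha> = int and \<epsilon> = ?\<epsilon> and N = "n * Suc n"])
    fix q assume q: "q < n * Suc n"
    let ?s = "filled s ''q'' ''T'' int ?\<epsilon> q"
    have ij: "aval row_of ?s = int (q div Suc n)" "aval col_of ?s = int (q mod Suc n)"
        "aval (Var ''i'') ?s = int r"
      using m r by (simp_all add: aval_row_of aval_col_of)
    have m': "?s ''m'' 0 = int (Suc n)" using m by simp
    have s: "?s ''S'' = s ''S''" by simp
    note q' = matrix_index[OF q]
    have rn: "r \<le> n" using r by simp
    show "aval (Add (Quo (Sub (Mul (cell ''S'' (Var ''i'') (Var ''i'')) (cell ''S'' row_of col_of))
                    (Mul (cell ''S'' row_of (Var ''i'')) (cell ''S'' (Var ''i'') col_of)))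
               (Var ''p''))
          (Mul (Equal row_of (Var ''i'')) (cell ''S'' (Var ''i'') col_of))) ?s = ?\<epsilon> q"
      unfolding aval.simps(3-6) aval_Equal aval_cell[OF ij(3) ij(3) m'] aval_cell[OF ij(1) ij(2) m']
        aval_cell[OF ij(1) ij(3) m'] aval_cell[OF ij(3) ij(2) m'] s S[OF r(2) rn] S[OF q'(1,2)]
        S[OF q'(1) rn] S[OF r(2) q'(2)] new[OF q'(1), symmetric] ij
      using p by simp
    show "int_size (?\<epsilon> q) \<le> w" using w(2) q'(2) by simp
  qed (use n m w(1) in \<open>simp_all add: distrib_left\<close>)
  have copy: "achieves w copy_com (\<lambda>s'. s' = ?s2) ?s1"
    unfolding copy_com_def
  proof (rule achieves_For_Write[where \<alpha> = int and \<epsilon> = ?\<epsilon> and N = "n * Suc n"])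
    fix q assume q: "q < n * Suc n"
    then show "int_size (?\<epsilon> q) \<le> w" using w(2) matrix_index(2)[OF q] by simp
    show "aval (Read ''T'' (Var ''q'')) (filled ?s1 ''q'' ''S'' int ?\<epsilon> q) = ?\<epsilon> q"
      using q by (simp add: scatter_int)
  qed (use n m w(1) in \<open>simp_all add: distrib_left\<close>)
  have c: "aval (cell ''S'' (Var ''i'') (Var ''i'')) ?s2 = ?S' r r"
  proof -
    have "aval (cell ''S'' (Var ''i'') (Var ''i'')) ?s2 = ?s2 ''S'' (int (r * Suc n + r))"
      using m r by (intro aval_cell) simp_all
    also have "\<dots> = ?S' r r"
      using S2[of ?s2, OF refl] r(2) by (simp only: holds_matrix_def less_imp_le)
    finally show ?thesis .
  qed
  let ?s3 = "store ?s2 ''p'' (aval (Const 0) ?s2) (aval (cell ''S'' (Var ''i'') (Var ''i'')) ?s2)"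
  let ?s4 = "store ?s3 ''d'' (aval (Var ''i'') ?s3) (aval (Const 1) ?s3)"
  let ?s5 = "store ?s4 ''i'' (aval (Const 0) ?s4) (aval (Const 0) ?s4)"
  have tab: "holds_tableau n a (insert r D) ?s5 \<and> ?s5 ''i'' 0 = 0"
    unfolding holds_tableau_def
  proof (intro conjI)
    show "holds_matrix n ?s5 ''S'' ?S'" by (rule S2) simp
    show "pivot_invariant n a (insert r D)" by (rule inv')
    show "?s5 ''p'' 0 = pivot_det n a (insert r D)"
      using c by (simp add: pivot_det_insert[OF r(2)] tableau_insert_same[OF r(2)])
  qed (use n m r d in simp_all)
  have "achieves w (Seq (Assign ''p'' (cell ''S'' (Var ''i'') (Var ''i'')))
      (Seq (Write ''d'' (Var ''i'') (Const 1)) (Assign ''i'' (Const 0))))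
      (\<lambda>s'. holds_tableau n a (insert r D) s' \<and> s' ''i'' 0 = 0) ?s2"
    by (rule achieves_Seq, rule achieves_Write, unfold c, use w(2) r in simp,
        rule achieves_Seq, rule achieves_Write, use w1 in simp,
        rule achieves_Write, use w1 in simp, fold c, rule tab)
  note final = this
  show ?thesis
    unfolding pivot_com_def
    by (rule achieves_Seq, rule achieves_mono[OF eliminate], hypsubst,
        rule achieves_Seq, rule achieves_mono[OF copy], hypsubst, rule final)
qed

lemma holds_tableau_upd_i [simp]: "holds_tableau n a D (s(''i'' := f)) = holds_tableau n a D s"
  by (simp add: holds_tableau_def holds_matrix_def)

lemma achieves_solve:
  assumes s: "holds_tableau n a {} s"
    and w: "Suc n * Suc n < w" "\<And>i k D. k \<le> n \<Longrightarrow> int_size (tableau n a D i k) \<le> w"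
  shows "achieves w solve_com (\<lambda>s'. \<exists>D. holds_tableau n a D s' \<and>
    (\<forall>i<n. i \<notin> D \<longrightarrow> tableau n a D i n \<le> 0)) s"
  unfolding solve_com_def
proof (rule achieves_Seq, rule achieves_Write)
  show "int_size (aval (Const 0) s) \<le> w" using int_size_of_nat[of 0] w(1) by simp
  let ?I = "\<lambda>D r s. holds_tableau n a D s \<and> s ''i'' 0 = int r \<and> r \<le> n \<and>
      (\<forall>l<r. l \<notin> D \<longrightarrow> tableau n a D l n \<le> 0)"
  \<comment> \<open>A pivot lowers the first summand by \<open>Suc n\<close>, while resetting the
    scan raises the second by less than that. The initial value \<open>n * Suc n + n\<close> is
    \<open>Suc n * Suc n - 1\<close>.\<close>
  let ?m = "\<lambda>s. card {i. i < n \<and> s ''d'' (int i) = 0} * Suc n + (n - nat (s ''i'' 0))"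
  have m: "?m s = card ({..<n} - D) * Suc n + (n - r)" if I: "?I D r s" for D r s
  proof -
    have "{i. i < n \<and> s ''d'' (int i) = 0} = {..<n} - D"
      using I by (auto simp: holds_tableau_def split: if_splits)
    then show ?thesis using I by simp
  qed
  show "achieves w (Loop (Less (Var ''i'') (Var ''n''))
     (Cond (Conj (Less (Read ''d'' (Var ''i'')) (Const 1))
                 (Less (Const 0) (cell ''S'' (Var ''i'') (Var ''n''))))
        pivot_com (Assign ''i'' (Add (Var ''i'') (Const 1)))))
     (\<lambda>s'. \<exists>D. holds_tableau n a D s' \<and> (\<forall>i<n. i \<notin> D \<longrightarrow> tableau n a D i n \<le> 0))
     (store s ''i'' (aval (Const 0) s) (aval (Const 0) s))" (is "achieves w _ ?Q ?s0")
  proof (rule achieves_Loop[where I = "\<lambda>s. \<exists>D r. ?I D r s" and m = ?m])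
    have I0: "?I {} 0 ?s0"
      using s by simp
    then show "\<exists>D r. ?I D r ?s0" by blast
    have "?m ?s0 = n * Suc n + n" unfolding m[OF I0] by simp
    then show "?m ?s0 \<le> w" using w(1) by simp
  next
    fix s assume "\<exists>D r. ?I D r s" and "\<not> bval (Less (Var ''i'') (Var ''n'')) s"
    then obtain D r where I: "?I D r s" by blast
    moreover have "r = n" using I \<open>\<not> bval _ s\<close> by (simp add: holds_tableau_def)
    ultimately show "?Q s" by blast
  next
    fix s assume "\<exists>D r. ?I D r s" and b: "bval (Less (Var ''i'') (Var ''n'')) s"
    then obtain D r where I: "?I D r s" by blast
    then have tab: "holds_tableau n a D s" and r: "s ''i'' 0 = int r" by simp_all
    then have rn: "r < n" using b by (simp add: holds_tableau_def)
    have c: "aval (cell ''S'' (Var ''i'') (Var ''n'')) s = tableau n a D r n"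
    proof -
      have "s ''S'' (int (r * Suc n + n)) = tableau n a D r n"
        using tab rn by (simp only: holds_tableau_def holds_matrix_def order_refl)
      then show ?thesis
        using tab r by (subst aval_cell[of _ _ r _ n "Suc n"]) (simp_all add: holds_tableau_def)
    qed
    have dr: "s ''d'' (int r) = of_bool (r \<in> D)"
      using tab rn by (simp add: holds_tableau_def)
    show "achieves w (Cond (Conj (Less (Read ''d'' (Var ''i'')) (Const 1))
                 (Less (Const 0) (cell ''S'' (Var ''i'') (Var ''n''))))
        pivot_com (Assign ''i'' (Add (Var ''i'') (Const 1))))
        (\<lambda>s'. (\<exists>D r. ?I D r s') \<and> ?m s' < ?m s) s"
    proof (rule achieves_Cond)
      assume "bval (Conj (Less (Read ''d'' (Var ''i'')) (Const 1))
                 (Less (Const 0) (cell ''S'' (Var ''i'') (Var ''n'')))) s"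
      then have rD: "r \<notin> D" and pos: "0 < tableau n a D r n"
        using dr r c by (simp_all split: if_splits)
      have "n * Suc n < w" using w(1) by simp
      note piv = achieves_pivot[OF tab r rn rD pos this w(2)]
      show "achieves w pivot_com (\<lambda>s'. (\<exists>D r. ?I D r s') \<and> ?m s' < ?m s) s"
      proof (rule achieves_mono[OF piv])
        fix s' assume "holds_tableau n a (insert r D) s' \<and> s' ''i'' 0 = 0"
        then have I': "?I (insert r D) 0 s'" by simp
        have "card ({..<n} - D) = Suc (card ({..<n} - insert r D))"
          using rn rD card.remove[of "{..<n} - D" r] Diff_insert[of "{..<n}" r D] by simp
        then have "?m s' < ?m s" unfolding m[OF I'] m[OF I] by simp
        then show "(\<exists>D r. ?I D r s') \<and> ?m s' < ?m s" using I' by blast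
      qed
    next
      assume "\<not> bval (Conj (Less (Read ''d'' (Var ''i'')) (Const 1))
                 (Less (Const 0) (cell ''S'' (Var ''i'') (Var ''n'')))) s"
      then have ok: "r \<notin> D \<longrightarrow> tableau n a D r n \<le> 0"
        using dr r c by (auto simp: not_less)
      show "achieves w (Assign ''i'' (Add (Var ''i'') (Const 1))) (\<lambda>s'. (\<exists>D r. ?I D r s') \<and> ?m s' < ?m s) s"
      proof (rule achieves_Write)
        have "Suc (Suc r) \<le> w" using rn w(1) by simp
        then show "int_size (aval (Add (Var ''i'') (Const 1)) s) \<le> w"
          using int_size_of_nat[of "Suc r"] r by (simp add: add.commute)
        let ?s = "store s ''i'' (aval (Const 0) s) (aval (Add (Var ''i'') (Const 1)) s)"
        have I': "?I D (Suc r) ?s"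
          using I rn ok by (simp add: less_Suc_eq)
        have "?m ?s < ?m s" unfolding m[OF I'] m[OF I] using rn by simp
        then show "(\<exists>D r. ?I D r ?s) \<and> ?m ?s < ?m s" using I' by blast
      qed
    qed
  qed
qed

text \<open>Numerators go to odd addresses and the common denominator to positive even ones, in two
  loops so that each consists of a single assignment. The array \<open>d\<close> acts as a 0/1 mask
  that turns column \<open>n\<close> into the basic solution.\<close>

definition output_com :: com where
  "output_com = Seq (Assign ''out'' (Mul (Const 2) (Var ''n'')))
    (Seq (For ''q'' (Var ''n'') (Write ''out'' (Add (Mul (Const 2) (Var ''q'')) (Const 1))
       (Sub (Var ''p'') (Mul (Read ''d'' (Var ''q'')) (cell ''S'' (Var ''q'') (Var ''n''))))))
      (For ''q'' (Var ''n'') (Write ''out'' (Add (Mul (Const 2) (Var ''q'')) (Const 2)) (Var ''p''))))"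

lemma achieves_output:
  assumes s: "holds_tableau n a D s" and w: "2 * n < w" "int_size (pivot_det n a D) \<le> w"
  shows "achieves w output_com (\<lambda>s'. has_output s' (concat (map
    (\<lambda>i. [pivot_det n a D - pivot_solution n a D i, pivot_det n a D]) [0..<n]))) s"
proof -
  let ?\<Delta> = "pivot_det n a D" and ?y = "pivot_solution n a D"
  let ?\<alpha> = "\<lambda>q. 2 * int q + 1" and ?\<beta> = "\<lambda>q. 2 * int q + 2"
  let ?s0 = "store s ''out'' 0 (2 * int n)"
  let ?s1 = "filled ?s0 ''q'' ''out'' ?\<alpha> (\<lambda>q. ?\<Delta> - ?y q) n"
  let ?s2 = "filled ?s1 ''q'' ''out'' ?\<beta> (\<lambda>q. ?\<Delta>) n"
  let ?zs = "\<lambda>n. concat (map (\<lambda>i. [?\<Delta> - ?y i, ?\<Delta>]) [0..<n])"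
  from s have n: "s ''n'' 0 = int n" and m: "s ''m'' 0 = int (Suc n)"
    and inv: "pivot_invariant n a D" and p: "s ''p'' 0 = ?\<Delta>"
    and S: "\<And>i k. i < n \<Longrightarrow> k \<le> n \<Longrightarrow> s ''S'' (int (i * Suc n + k)) = tableau n a D i k"
    and d: "\<And>i. i < n \<Longrightarrow> s ''d'' (int i) = of_bool (i \<in> D)"
    by (simp_all add: holds_tableau_def holds_matrix_def)
  have inj: "inj ?\<alpha>" "inj ?\<beta>" by (simp_all add: inj_def)
  have len: "length (?zs n) = 2 * n" for n by (induction n) simp_all
  have zs: "?zs n ! (2 * q) = ?\<Delta> - ?y q \<and> ?zs n ! (2 * q + 1) = ?\<Delta>" if "q < n" for q n
  proof -
    have "?zs n ! (q * 2 + j) = [?\<Delta> - ?y q, ?\<Delta>] ! j" if "j < 2" for j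
      using that \<open>q < n\<close> by (intro nth_concat_uniform) simp_all
    from this[of 0] this[of 1] show ?thesis by (simp add: mult.commute)
  qed
  have out: "has_output s' (?zs n)" if s': "s' ''out'' = ?s2 ''out''" for s'
    unfolding has_output_def s'
  proof (intro conjI allI impI)
    have "0 \<notin> ?\<beta> ` {..<n}" "0 \<notin> ?\<alpha> ` {..<n}" by force+
    then show "?s2 ''out'' 0 = int (length (?zs n))"
      unfolding len by (simp add: scatter_outside)
    fix i assume "i < length (?zs n)"
    then have i: "i < 2 * n" unfolding len .
    show "?s2 ''out'' (int i + 1) = ?zs n ! i"
    proof (cases "even i")
      case True
      then obtain q where q: "i = 2 * q" by blast
      then have qn: "q < n" using i by simp
      \<comment> \<open>The second loop writes to even addresses only and leaves this odd one
        alone.\<close>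
      have "int i + 1 \<noteq> ?\<beta> l" for l using q by presburger
      then have "?s2 ''out'' (int i + 1) = scatter (?s0 ''out'') ?\<alpha> (\<lambda>q. ?\<Delta> - ?y q) n (?\<alpha> q)"
        using q by (subst fun_upd_same, subst scatter_outside) auto
      then show ?thesis using zs[OF qn] qn q by (simp only: scatter_inside[OF inj(1)])
    next
      case False
      then obtain q where q: "i = 2 * q + 1" by (blast elim: oddE)
      then have qn: "q < n" using i by simp
      have "?s2 ''out'' (int i + 1) = scatter (?s1 ''out'') ?\<beta> (\<lambda>q. ?\<Delta>) n (?\<beta> q)"
        using q by (simp add: add.commute)
      then show ?thesis using zs[OF qn] qn q by (simp only: scatter_inside[OF inj(2)])
    qed
  qed
  have c: "aval (cell ''S'' (Var ''q'') (Var ''n'')) (filled ?s0 ''q'' ''out'' \<alpha> \<epsilon> q) = tableau n a D q n"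
    if "q < n" for q \<alpha> \<epsilon>
    using that n m S[OF that order_refl] by (subst aval_cell[of _ _ q _ n "Suc n"]) simp_all
  show ?thesis
    unfolding output_com_def
  proof (intro achieves_Seq achieves_Write)
    show "int_size (aval (Mul (Const 2) (Var ''n'')) s) \<le> w"
      using int_size_of_nat[of "2 * n"] w(1) n by simp
    show "achieves w (For ''q'' (Var ''n'') (Write ''out'' (Add (Mul (Const 2) (Var ''q'')) (Const 1))
       (Sub (Var ''p'') (Mul (Read ''d'' (Var ''q'')) (cell ''S'' (Var ''q'') (Var ''n''))))))
      (achieves w (For ''q'' (Var ''n'') (Write ''out'' (Add (Mul (Const 2) (Var ''q'')) (Const 2)) (Var ''p'')))
         (\<lambda>s'. has_output s' (?zs n)))
      (store s ''out'' (aval (Const 0) s) (aval (Mul (Const 2) (Var ''n'')) s))"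
    proof (rule achieves_For_Write[where \<alpha> = ?\<alpha> and \<epsilon> = "\<lambda>q. ?\<Delta> - ?y q" and N = n])
      fix q assume q: "q < n"
      show "int_size (?\<Delta> - ?y q) \<le> w"
        using pivot_solution_bounds[OF inv, of q] by (intro le_trans[OF int_size_mono w(2)]) simp
      have "?y q = of_bool (q \<in> D) * tableau n a D q n" by (simp add: pivot_solution_def)
      then show "aval (Sub (Var ''p'') (Mul (Read ''d'' (Var ''q'')) (cell ''S'' (Var ''q'') (Var ''n''))))
          (filled (store s ''out'' (aval (Const 0) s) (aval (Mul (Const 2) (Var ''n'')) s)) ''q'' ''out''
            ?\<alpha> (\<lambda>q. ?\<Delta> - ?y q) q) = ?\<Delta> - ?y q"
        using c[OF q] p d[OF q] n by simp
    next
      show "achieves w (For ''q'' (Var ''n'') (Write ''out'' (Add (Mul (Const 2) (Var ''q'')) (Const 2)) (Var ''p'')))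
        (\<lambda>s'. has_output s' (?zs n))
        (filled (store s ''out'' (aval (Const 0) s) (aval (Mul (Const 2) (Var ''n'')) s)) ''q'' ''out''
            ?\<alpha> (\<lambda>q. ?\<Delta> - ?y q) n)"
      proof (rule achieves_For_Write[where \<alpha> = ?\<beta> and \<epsilon> = "\<lambda>q. ?\<Delta>" and N = n])
        show "has_output (filled (filled (store s ''out'' (aval (Const 0) s) (aval (Mul (Const 2) (Var ''n'')) s)) ''q'' ''out''
            ?\<alpha> (\<lambda>q. ?\<Delta> - ?y q) n) ''q'' ''out'' ?\<beta> (\<lambda>q. ?\<Delta>) n) (?zs n)"
          by (rule out) (simp add: n)
      qed (use n p w in simp_all)
    qed (use n p w in simp_all)
  qed
qed

text \<open>
  The sum over \<open>j < n\<close> is the entry of the deficit matrix in row \<open>i\<close> and column \<open>k\<close>, where \<open>v\<close>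
  lists the network data multiplied by \<open>g\<close>.  For \<open>k = n\<close> the first summand reads an unrelated
  cell of \<open>v\<close>, but its factor is \<open>0\<close>.
\<close>

definition contribution :: "nat \<Rightarrow> (nat \<Rightarrow> int) \<Rightarrow> nat \<Rightarrow> nat \<Rightarrow> nat \<Rightarrow> int" where
  "contribution n v j i k =
     (1 - of_bool (k = n)) * v (n + n * n + ((j * n + i) * n + k)) +
     (of_bool (k = i) + of_bool (k = n)) * v (n + (i * n + j)) -
     (of_bool (k = j) + of_bool (k = n)) * v (n + (j * n + i)) -
     of_bool (k = n) * of_bool (j = i) * v i"

definition system_matrix :: "nat \<Rightarrow> (nat \<Rightarrow> int) \<Rightarrow> nat \<Rightarrow> nat \<Rightarrow> int" where
  "system_matrix n v i k = (\<Sum>j<n. contribution n v j i k)"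

definition contribution_exp :: aexp where
  "contribution_exp =
     Sub (Sub (Add
       (Mul (Sub (Const 1) (Equal col_of (Var ''n'')))
         (Read ''v'' (Add (Add (Var ''n'') (Mul (Var ''n'') (Var ''n'')))
           (Add (Mul (Add (Mul (Var ''j'') (Var ''n'')) row_of) (Var ''n'')) col_of))))
       (Mul (Add (Equal col_of row_of) (Equal col_of (Var ''n'')))
         (Read ''v'' (Add (Var ''n'') (Add (Mul row_of (Var ''n'')) (Var ''j''))))))
       (Mul (Add (Equal col_of (Var ''j'')) (Equal col_of (Var ''n'')))
         (Read ''v'' (Add (Var ''n'') (Add (Mul (Var ''j'') (Var ''n'')) row_of)))))
       (Mul (Mul (Equal col_of (Var ''n'')) (Equal (Var ''j'') row_of)) (Read ''v'' row_of))"

lemma aval_contribution_exp: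
  assumes n: "s ''n'' 0 = int n" and m: "s ''m'' 0 = int (Suc n)" and j: "s ''j'' 0 = int j"
    and q: "s ''q'' 0 = int q"
  shows "aval contribution_exp s =
    contribution n (\<lambda>l. s ''v'' (int l)) j (q div Suc n) (q mod Suc n)"
proof -
  have vars: "aval (Var ''n'') s = int n" "aval (Var ''j'') s = int j"
      "aval row_of s = int (q div Suc n)" "aval col_of s = int (q mod Suc n)"
    using n m j q by (simp_all add: aval_row_of aval_col_of del: mult_Suc_right of_nat_Suc)
  show ?thesis
    unfolding contribution_exp_def contribution_def aval.simps(1,3-6) aval.simps(2)[of "''v''"]
      aval_Equal vars of_nat_eq_iff
      of_nat_add[symmetric] of_nat_mult[symmetric] ..
qed

definition matrix_com :: com where
  "matrix_com = Seq (For ''j'' (Var ''n'') (For ''q'' (Mul (Var ''n'') (Var ''m''))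
       (Write ''S'' (Var ''q'') (Add (Read ''S'' (Var ''q'')) contribution_exp))))
     (Assign ''p'' (Const 1))"

text \<open>All entries receive the contribution of one \<open>j\<close> before the next
  \<open>j\<close> starts. Partial sums therefore stand in memory, and the length bound is required
  for each of them.\<close>

lemma achieves_matrix:
  fixes s :: state and n :: nat
  defines "v \<equiv> \<lambda>l. s ''v'' (int l)"
  assumes n: "s ''n'' 0 = int n" and m: "s ''m'' 0 = int (Suc n)"
    and S: "s ''S'' = (\<lambda>_. 0)" and d: "s ''d'' = (\<lambda>_. 0)"
    and inv: "pivot_invariant n (system_matrix n v) {}"
    and w: "Suc (n * Suc n) < w"
      "\<And>l i k. l \<le> n \<Longrightarrow> i < n \<Longrightarrow> k \<le> n \<Longrightarrow> int_size (\<Sum>j<l. contribution n v j i k) \<le> w"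
  shows "achieves w matrix_com (holds_tableau n (system_matrix n v) {}) s"
proof -
  let ?sum = "\<lambda>l q. \<Sum>j<l. contribution n v j (q div Suc n) (q mod Suc n)"
  let ?I = "\<lambda>l s'. s' ''n'' 0 = int n \<and> s' ''m'' 0 = int (Suc n) \<and> s' ''v'' = s ''v'' \<and>
      s' ''d'' = (\<lambda>_. 0) \<and> (\<forall>q<n * Suc n. s' ''S'' (int q) = ?sum l q)"
  have "achieves w (For ''j'' (Var ''n'') (For ''q'' (Mul (Var ''n'') (Var ''m''))
       (Write ''S'' (Var ''q'') (Add (Read ''S'' (Var ''q'')) contribution_exp)))) (?I n) s"
  proof (rule achieves_For[where I = ?I and N = n])
    show "?I 0 (store s ''j'' 0 0)" using n m S d by simp
  next
    fix l s' assume l: "l < n" and I: "?I l s'" and j: "s' ''j'' 0 = int l"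
    show "achieves w (For ''q'' (Mul (Var ''n'') (Var ''m''))
       (Write ''S'' (Var ''q'') (Add (Read ''S'' (Var ''q'')) contribution_exp)))
       (\<lambda>s'. s' ''j'' 0 = int l \<and> ?I (Suc l) (store s' ''j'' 0 (int (Suc l)))) s'"
    proof (rule achieves_For_Write[where \<alpha> = int and \<epsilon> = "?sum (Suc l)" and N = "n * Suc n"])
      fix q assume q: "q < n * Suc n"
      have "aval contribution_exp (filled s' ''q'' ''S'' int (?sum (Suc l)) q) =
          contribution n v l (q div Suc n) (q mod Suc n)"
        using I j unfolding v_def by (subst aval_contribution_exp) simp_all
      moreover have "s' ''S'' (int q) = ?sum l q" using I q by blast
      ultimately show "aval (Add (Read ''S'' (Var ''q'')) contribution_exp)
          (filled s' ''q'' ''S'' int (?sum (Suc l)) q) = ?sum (Suc l) q"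
        by (simp add: scatter_int)
      show "int_size (?sum (Suc l) q) \<le> w"
        using w(2) matrix_index[OF q] l by (simp only: Suc_le_eq)
    next
      let ?s = "filled s' ''q'' ''S'' int (?sum (Suc l)) (n * Suc n)"
      have "\<forall>q<n * Suc n. ?s ''S'' (int q) = ?sum (Suc l) q"
        by (simp add: scatter_int)
      then show "?s ''j'' 0 = int l \<and> ?I (Suc l) (store ?s ''j'' 0 (int (Suc l)))"
        using I j by simp
    qed (use I w(1) in \<open>simp_all add: distrib_left\<close>)
  qed (use w(1) in auto)
  then show ?thesis
    unfolding matrix_com_def
  proof (rule achieves_Seq[OF achieves_mono], intro achieves_Write)
    fix s' assume I: "?I n s'"
    show "int_size (aval (Const 1) s') \<le> w"
      using int_size_of_nat[of 1] w(1) by simp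
    let ?s = "store s' ''p'' (aval (Const 0) s') (aval (Const 1) s')"
    have "holds_matrix n ?s ''S'' (system_matrix n v)"
      unfolding holds_matrix_iff system_matrix_def using I by simp
    then have "holds_matrix n ?s ''S'' (tableau n (system_matrix n v) {})"
      by (simp add: holds_matrix_def tableau_empty)
    then show "holds_tableau n (system_matrix n v) {} ?s"
      using I inv by (simp add: holds_tableau_def)
  qed
qed

text \<open>Cell 0 of the input array holds its length \<open>2 * c + 1\<close> and cell 1 the
  number of banks; numerator \<open>l\<close> stands at \<open>2 * l + 2\<close>, its denominator at
  \<open>2 * l + 3\<close>. The plain product of all denominators serves as common denominator: it
  requires no gcd, and its length exceeds the input size by a constant at most.\<close>

definition read_com :: com where
  "read_com =
     Seq (Assign ''n'' (Read ''in'' (Const 1)))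
    (Seq (Assign ''m'' (Add (Var ''n'') (Const 1)))
    (Seq (Assign ''c'' (Quo (Var ''in'') (Const 2)))
    (Seq (Assign ''g'' (Const 1))
    (Seq (For ''q'' (Var ''c'') (Assign ''g''
            (Mul (Var ''g'') (Read ''in'' (Add (Mul (Const 2) (Var ''q'')) (Const 3))))))
         (For ''q'' (Var ''c'') (Write ''v'' (Var ''q'')
            (Mul (Read ''in'' (Add (Mul (Const 2) (Var ''q'')) (Const 2)))
                 (Quo (Var ''g'') (Read ''in'' (Add (Mul (Const 2) (Var ''q'')) (Const 3)))))))))))"

definition denominator_prod :: "int list \<Rightarrow> nat \<Rightarrow> int" where
  "denominator_prod ds k = (\<Prod>l<k. ds ! (2 * l + 1))"

definition scaled_numerator :: "int list \<Rightarrow> nat \<Rightarrow> nat \<Rightarrow> int" where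
  "scaled_numerator ds c l = ds ! (2 * l) * (denominator_prod ds c div ds ! (2 * l + 1))"

lemma achieves_read:
  assumes len: "length ds = 2 * c" and w: "Suc n < w" "2 * c < w"
    and w': "\<And>k. k \<le> c \<Longrightarrow> int_size (denominator_prod ds k) \<le> w"
      "\<And>l. l < c \<Longrightarrow> int_size (scaled_numerator ds c l) \<le> w"
  shows "achieves w read_com (\<lambda>s. s ''n'' 0 = int n \<and> s ''m'' 0 = int (Suc n) \<and>
      s ''S'' = (\<lambda>_. 0) \<and> s ''d'' = (\<lambda>_. 0) \<and>
      (\<forall>l<c. s ''v'' (int l) = scaled_numerator ds c l)) (input_state (int n # ds))"
proof -
  let ?in = "input_state (int n # ds) ''in''"
  have in0: "?in 0 = int (2 * c) + 1" and in1: "?in 1 = int n"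
    by (simp_all add: input_state_def len)
  have num: "?in (2 * int l + 2) = ds ! (2 * l)" and den: "?in (2 * int l + 3) = ds ! (2 * l + 1)"
    if "l < c" for l
  proof -
    have "nat (2 * int l + 2 - 1) = Suc (2 * l)" "nat (2 * int l + 3 - 1) = Suc (2 * l + 1)"
      by (simp_all add: nat_eq_iff)
    then show "?in (2 * int l + 2) = ds ! (2 * l)" "?in (2 * int l + 3) = ds ! (2 * l + 1)"
      using that len by (simp_all add: input_state_def)
  qed
  let ?s0 = "input_state (int n # ds)"
  let ?s1 = "store ?s0 ''n'' 0 (int n)"
  let ?s2 = "store ?s1 ''m'' 0 (int (Suc n))"
  let ?s3 = "store ?s2 ''c'' 0 (int c)"
  let ?s4 = "store ?s3 ''g'' 0 1"
  let ?J = "\<lambda>s. s ''in'' = ?in \<and> s ''n'' 0 = int n \<and> s ''m'' 0 = int (Suc n) \<and> s ''c'' 0 = int c \<and>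
      s ''S'' = (\<lambda>_. 0) \<and> s ''d'' = (\<lambda>_. 0)"
  let ?Q = "\<lambda>s. s ''n'' 0 = int n \<and> s ''m'' 0 = int (Suc n) \<and> s ''S'' = (\<lambda>_. 0) \<and> s ''d'' = (\<lambda>_. 0) \<and>
      (\<forall>l<c. s ''v'' (int l) = scaled_numerator ds c l)"
  let ?prod = "For ''q'' (Var ''c'') (Assign ''g''
            (Mul (Var ''g'') (Read ''in'' (Add (Mul (Const 2) (Var ''q'')) (Const 3)))))"
  let ?scale = "For ''q'' (Var ''c'') (Write ''v'' (Var ''q'')
            (Mul (Read ''in'' (Add (Mul (Const 2) (Var ''q'')) (Const 2)))
                 (Quo (Var ''g'') (Read ''in'' (Add (Mul (Const 2) (Var ''q'')) (Const 3))))))"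
  have zero: "?s0 x = (\<lambda>_. 0)" if "x \<noteq> ''in''" for x
    using that by (simp add: input_state_def)
  have J: "?J ?s4" by (simp add: zero)
  have prod: "achieves w ?prod (\<lambda>s. ?J s \<and> s ''g'' 0 = denominator_prod ds c) ?s4"
  proof (rule achieves_For[where I = "\<lambda>k s. ?J s \<and> s ''g'' 0 = denominator_prod ds k" and N = c])
    show "?J (store ?s4 ''q'' 0 0) \<and> store ?s4 ''q'' 0 0 ''g'' 0 = denominator_prod ds 0"
      using J by (simp add: denominator_prod_def)
  next
    fix k s assume k: "k < c" and I: "?J s \<and> s ''g'' 0 = denominator_prod ds k" and q: "s ''q'' 0 = int k"
    have g: "aval (Mul (Var ''g'') (Read ''in'' (Add (Mul (Const 2) (Var ''q'')) (Const 3)))) s =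
        denominator_prod ds (Suc k)"
      using I q den[OF k] by (simp add: denominator_prod_def)
    show "achieves w (Assign ''g'' (Mul (Var ''g'') (Read ''in'' (Add (Mul (Const 2) (Var ''q'')) (Const 3)))))
      (\<lambda>s'. s' ''q'' 0 = int k \<and> ?J (store s' ''q'' 0 (int (Suc k))) \<and>
        store s' ''q'' 0 (int (Suc k)) ''g'' 0 = denominator_prod ds (Suc k)) s"
    proof (rule achieves_Write, unfold g)
      show "int_size (denominator_prod ds (Suc k)) \<le> w" using w'(1)[of "Suc k"] k by simp
    qed (use I q in simp)
  qed (use w in simp_all)
  have scale: "achieves w ?scale ?Q s" if I: "?J s \<and> s ''g'' 0 = denominator_prod ds c" for s
  proof (rule achieves_For_Write[where \<alpha> = int and \<epsilon> = "scaled_numerator ds c" and N = c])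
    fix k assume k: "k < c"
    show "aval (Mul (Read ''in'' (Add (Mul (Const 2) (Var ''q'')) (Const 2)))
        (Quo (Var ''g'') (Read ''in'' (Add (Mul (Const 2) (Var ''q'')) (Const 3)))))
        (filled s ''q'' ''v'' int (scaled_numerator ds c) k) = scaled_numerator ds c k"
      using I num[OF k] den[OF k] by (simp add: scaled_numerator_def)
    show "int_size (scaled_numerator ds c k) \<le> w" using w'(2)[OF k] .
  next
    show "?Q (filled s ''q'' ''v'' int (scaled_numerator ds c) c)"
      using I by (simp add: scatter_int)
  qed (use I w in simp_all)
  have size: "int_size (int k) \<le> w" if "k < w" for k
    using int_size_of_nat[of k] that by simp
  have e: "aval (Read ''in'' (Const 1)) ?s0 = int n" "aval (Add (Var ''n'') (Const 1)) ?s1 = int (Suc n)"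
      "aval (Quo (Var ''in'') (Const 2)) ?s2 = int c" "aval (Const 1) ?s3 = 1"
    using in0 in1 by simp_all
  show ?thesis
    unfolding read_com_def
    by (rule achieves_Seq, rule achieves_Write, unfold e(1) aval.simps(1), rule size, use w in simp,
        rule achieves_Seq, rule achieves_Write, unfold e(2) aval.simps(1), rule size, use w in simp,
        rule achieves_Seq, rule achieves_Write, unfold e(3) aval.simps(1), rule size, use w in simp,
        rule achieves_Seq, rule achieves_Write, unfold e(4) aval.simps(1), use size[of 1] w in simp,
        rule achieves_Seq, rule achieves_mono[OF prod], rule scale)
qed

section \<open>Encoded networks and size bounds\<close>

lemma length_network_data:
  "length (network_data N) = nbanks N + nbanks N * nbanks N + nbanks N * nbanks N * nbanks N"
  by (simp add: network_data_def Let_def length_concat_uniform[where m = "nbanks N"]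
      length_concat_uniform[where m = "nbanks N * nbanks N"])

lemma
  fixes N :: network
  defines "n \<equiv> nbanks N"
  assumes i: "i < n" and j: "j < n"
  shows network_data_ext: "network_data N ! i = ext N i"
    and network_data_debt: "network_data N ! (n + (i * n + j)) = debt N i j"
    and network_data_cds: "k < n \<Longrightarrow> network_data N ! (n + n * n + ((i * n + j) * n + k)) = cds N i j k"
proof -
  let ?E = "map (ext N) [0..<n]"
  let ?C = "concat (map (\<lambda>i. map (\<lambda>j. debt N i j) [0..<n]) [0..<n])"
  let ?K = "concat (map (\<lambda>i. concat (map (\<lambda>j. map (\<lambda>k. cds N i j k) [0..<n]) [0..<n])) [0..<n])"
  have nd: "network_data N = ?E @ ?C @ ?K"
    by (simp add: network_data_def Let_def n_def)
  have len: "length ?E = n" "length ?C = n * n"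
    by (simp_all add: length_concat_uniform[where m = n])
  show "network_data N ! i = ext N i"
    using i unfolding nd by (simp add: nth_append)
  have "?C ! (i * n + j) = debt N i j"
    using i j by (subst nth_concat_uniform) simp_all
  then show "network_data N ! (n + (i * n + j)) = debt N i j"
    using len index_less[OF i j] unfolding nd by (simp add: nth_append)
  assume k: "k < n"
  have "?K ! (i * (n * n) + (j * n + k)) = concat (map (\<lambda>j. map (\<lambda>k. cds N i j k) [0..<n]) [0..<n]) ! (j * n + k)"
    using i index_less[OF j k] by (intro nth_concat_uniform) (simp_all add: length_concat_uniform[where m = n])
  also have "\<dots> = cds N i j k"
    using j k by (subst nth_concat_uniform) simp_all
  also have "i * (n * n) + (j * n + k) = (i * n + j) * n + k"
    by (simp add: algebra_simps)
  finally have "?K ! ((i * n + j) * n + k) = cds N i j k" .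
  then show "network_data N ! (n + n * n + ((i * n + j) * n + k)) = cds N i j k"
    using len unfolding nd by (simp add: nth_append)
qed

lemma denominator_prod_pos:
  assumes "encodes_rats ds xs" and "k \<le> length xs"
  shows "0 < denominator_prod ds k"
  using assms by (auto simp: denominator_prod_def encodes_rats_def intro!: prod_pos)

text \<open>The division in \<open>scaled_numerator\<close> is exact, as the divisor is one of the
  factors of the product.\<close>

lemma scaled_numerator_eq:
  assumes ds: "encodes_rats ds xs" and l: "l < length xs"
  shows "of_int (scaled_numerator ds (length xs) l) = of_int (denominator_prod ds (length xs)) * xs ! l"
proof -
  let ?d = "ds ! (2 * l + 1)"
  have d: "0 < ?d" "xs ! l = of_int (ds ! (2 * l)) / of_int ?d"
    using ds l by (auto simp: encodes_rats_def)
  have "?d dvd denominator_prod ds (length xs)"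
    unfolding denominator_prod_def using l by (intro dvd_prodI) simp_all
  then obtain e where "denominator_prod ds (length xs) = ?d * e" by blast
  then show ?thesis using d by (simp add: scaled_numerator_def)
qed

lemma deficit_matrix_system_matrix:
  fixes N :: network
  defines "n \<equiv> nbanks N" and "c \<equiv> length (network_data N)"
  assumes ds: "encodes_rats ds (network_data N)"
    and v: "\<And>l. l < c \<Longrightarrow> v l = scaled_numerator ds c l"
  shows "deficit_matrix N (denominator_prod ds c) (system_matrix n v)"
proof -
  let ?g = "of_int (denominator_prod ds c) :: rat"
  have c: "c = n + n * n + n * n * n" by (simp add: c_def n_def length_network_data)
  have vl: "of_int (v l) = ?g * network_data N ! l" if "l < c" for l
    using scaled_numerator_eq[OF ds] v that by (simp add: c_def)
  have E: "of_int (v i) = ?g * ext N i" if "i < n" for i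
    using vl[of i] network_data_ext[of i N] that c by (simp add: n_def)
  have C: "of_int (v (n + (i * n + j))) = ?g * debt N i j" if "i < n" "j < n" for i j
    using vl[of "n + (i * n + j)"] network_data_debt[of i N j] index_less[OF that] that c by (simp add: n_def)
  have K: "of_int (v (n + n * n + ((j * n + i) * n + k))) = ?g * cds N j i k" if "j < n" "i < n" "k < n" for i j k
    using vl[of "n + n * n + ((j * n + i) * n + k)"] network_data_cds[of j N i k]
      index_less[OF index_less[OF that(1,2)] that(3)] that c by (simp add: n_def)
  show ?thesis
    unfolding deficit_matrix_def n_def[symmetric]
  proof (intro allI impI conjI)
    fix i assume i: "i < n"
    \<comment> \<open>The indicators attach to a single \<open>j\<close> what must be counted once:
      the external assets to \<open>j = i\<close> in column \<open>n\<close>, and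
      \<open>debt N k i\<close> to \<open>j = k\<close> in the other columns.\<close>
    have "of_int (contribution n v j i n) =
        ?g * (debt N i j - debt N j i - (if j = i then ext N i else 0))" if "j < n" for j
      using that i by (simp add: contribution_def C E right_diff_distrib)
    then show "of_int (system_matrix n v i n) = ?g * ((\<Sum>j<n. debt N i j) - (\<Sum>j<n. debt N j i) - ext N i)"
      using i by (simp add: system_matrix_def sum_distrib_left[symmetric] sum_subtractf)
    fix k assume k: "k < n"
    have "of_int (contribution n v j i k) =
        ?g * ((if k = i then debt N i j else 0) - (if j = k then debt N k i else 0) + cds N j i k)" if "j < n" for j
      using that i k by (auto simp: contribution_def C K right_diff_distrib distrib_left)
    then have "of_int (system_matrix n v i k) =
        ?g * (\<Sum>j<n. (if k = i then debt N i j else 0) - (if j = k then debt N k i else 0) + cds N j i k)"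
      by (simp add: system_matrix_def sum_distrib_left[symmetric])
    then show "of_int (system_matrix n v i k) =
        ?g * ((if k = i then \<Sum>j<n. debt N i j else 0) - debt N k i + (\<Sum>j<n. cds N j i k))"
      using k by (simp add: sum.distrib sum_subtractf)
  qed
qed

text \<open>One unit is the sign bit, the other is due to \<open>2 ^ w\<close> itself, which has
  \<open>w + 1\<close> binary digits.\<close>

lemma int_size_leI: "\<bar>k\<bar> \<le> 2 ^ w \<Longrightarrow> int_size k \<le> w + 2"
proof -
  assume "\<bar>k\<bar> \<le> 2 ^ w"
  then have "\<bar>k\<bar> < 2 ^ Suc w"
    unfolding power_Suc using zero_less_power[of "2 :: int" w] by linarith
  then show ?thesis
    using int_size_le_iff[of k "Suc w"] by simp
qed

lemma abs_le_power_int_size: "\<bar>k\<bar> \<le> 2 ^ int_size k"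
proof -
  have "\<bar>k\<bar> \<le> 2 ^ (int_size k - 1)" using abs_less_power_int_size[of k] by simp
  also have "\<dots> \<le> 2 ^ int_size k" by (rule power_increasing) simp_all
  finally show ?thesis .
qed

lemma sum_odd_le_sum_list:
  fixes f :: "'a \<Rightarrow> nat"
  assumes "2 * k \<le> length xs"
  shows "(\<Sum>l<k. f (xs ! (2 * l + 1))) \<le> (\<Sum>x\<leftarrow>xs. f x)"
proof -
  have "(\<Sum>l<k. f (xs ! (2 * l + 1))) = (\<Sum>i\<in>(\<lambda>l. 2 * l + 1) ` {..<k}. f (xs ! i))"
    by (subst sum.reindex) (auto simp: inj_on_def)
  also have "\<dots> \<le> (\<Sum>i\<in>{..<length xs}. f (xs ! i))"
    using assms by (intro sum_mono2) auto
  also have "\<dots> = (\<Sum>x\<leftarrow>xs. f x)"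
    by (simp add: sum_list_sum_nth atLeast0LessThan)
  finally show ?thesis .
qed

lemma abs_denominator_prod_le:
  assumes "2 * k \<le> length ds"
  shows "\<bar>denominator_prod ds k\<bar> \<le> 2 ^ input_size ds"
proof -
  have "\<bar>denominator_prod ds k\<bar> \<le> (\<Prod>l<k. 2 ^ int_size (ds ! (2 * l + 1)))"
    unfolding denominator_prod_def abs_prod by (intro prod_mono conjI abs_ge_zero abs_le_power_int_size)
  also have "\<dots> = 2 ^ (\<Sum>l<k. int_size (ds ! (2 * l + 1)))"
    by (simp add: power_sum)
  also have "\<dots> \<le> 2 ^ input_size ds"
    unfolding input_size_def by (intro power_increasing sum_odd_le_sum_list assms) simp
  finally show ?thesis .
qed

lemma int_size_le_input_size: "z \<in> set zs \<Longrightarrow> int_size z \<le> input_size zs"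
  unfolding input_size_def by (intro member_le_sum_list) simp_all

lemma length_le_input_size: "length zs \<le> input_size zs"
proof (induction zs)
  case (Cons z zs)
  then show ?case using int_size_pos[of z] by (simp add: input_size_def)
qed simp

lemma abs_scaled_numerator_le:
  assumes "length ds = 2 * c" and "l < c"
  shows "\<bar>scaled_numerator ds c l\<bar> \<le> 2 ^ (2 * input_size ds)"
proof -
  have "\<bar>ds ! (2 * l)\<bar> \<le> 2 ^ int_size (ds ! (2 * l))"
    by (rule abs_le_power_int_size)
  also have "\<dots> \<le> 2 ^ input_size ds"
    using assms by (intro power_increasing int_size_le_input_size nth_mem) simp_all
  finally have "\<bar>ds ! (2 * l)\<bar> \<le> 2 ^ input_size ds" .
  moreover have "\<bar>denominator_prod ds c div ds ! (2 * l + 1)\<bar> \<le> 2 ^ input_size ds"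
    using assms(1) by (intro order_trans[OF abs_div_le abs_denominator_prod_le]) simp
  ultimately have "\<bar>scaled_numerator ds c l\<bar> \<le> 2 ^ input_size ds * 2 ^ input_size ds"
    unfolding scaled_numerator_def abs_mult by (intro mult_mono) simp_all
  then show ?thesis by (simp add: power_add[symmetric] mult_2)
qed

text \<open>For \<open>k = n\<close> the swap term vanishes, for \<open>k < n\<close> that of the
  external assets. As \<open>i\<close> and \<open>j\<close> are below \<open>n\<close>, each
  coefficient that remains is 0 or 1 in absolute value, and at most three cells contribute.\<close>

lemma abs_contribution_le:
  assumes v: "\<And>l. l < n + n * n + n * n * n \<Longrightarrow> \<bar>v l\<bar> \<le> b"
    and ijk: "i < n" "j < n" "k \<le> n"
  shows "\<bar>contribution n v j i k\<bar> \<le> 3 * b"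
proof -
  have C: "\<bar>v (n + (i * n + j))\<bar> \<le> b" if "i < n" "j < n" for i j
    using index_less[OF that] by (intro v) simp
  have E: "\<bar>v i\<bar> \<le> b"
    using ijk by (intro v) simp
  have b: "0 \<le> b" using E by (rule order_trans[OF abs_ge_zero])
  show ?thesis
  proof (cases "k = n")
    case True
    then show ?thesis
      using C[OF ijk(1,2)] C[OF ijk(2,1)] E ijk b by (auto simp: contribution_def)
  next
    case False
    then have "k < n" using ijk by simp
    then have "\<bar>v (n + n * n + ((j * n + i) * n + k))\<bar> \<le> b"
      using index_less[OF index_less[OF ijk(2,1)]] by (intro v) simp
    then show ?thesis
      using C[OF ijk(1,2)] C[OF ijk(2,1)] b False by (auto simp: contribution_def)
  qed
qed

lemma abs_sum_contribution_le:
  assumes v: "\<And>l. l < n + n * n + n * n * n \<Longrightarrow> \<bar>v l\<bar> \<le> 2 ^ (2 * t)"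
    and n: "n \<le> t" and ik: "i < n" "k \<le> n" "l \<le> n"
  shows "\<bar>\<Sum>j<l. contribution n v j i k\<bar> \<le> 2 ^ (3 * t + 2)"
proof -
  have "\<bar>\<Sum>j<l. contribution n v j i k\<bar> \<le> (\<Sum>j<l. 3 * 2 ^ (2 * t))"
    using ik by (intro order_trans[OF sum_abs] sum_mono abs_contribution_le v) auto
  also have "\<dots> = int l * (3 * 2 ^ (2 * t))" by simp
  \<comment> \<open>Everything is rounded up to powers of 2, using \<open>l \<le> t < 2 ^ t\<close>
    and \<open>3 \<le> 2 ^ 2\<close>.\<close>
  also have "\<dots> \<le> 2 ^ t * (4 * 2 ^ (2 * t))"
  proof (intro mult_mono)
    have "int l \<le> int t" using n ik by simp
    also have "\<dots> \<le> 2 ^ t" using of_nat_less_two_power[of t, where 'a = int] by simp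
    finally show "int l \<le> 2 ^ t" .
  qed simp_all
  also have "\<dots> = 2 ^ (3 * t + 2)"
    by (simp add: power_add[symmetric])
  finally show ?thesis .
qed

text \<open>Entries are at most \<open>2 ^ (3 * t + 2)\<close> and
  \<open>fact n \<le> n ^ n\<close>, so the determinants are bounded by
  \<open>(2 ^ t * 2 ^ (3 * t + 2)) ^ t\<close>, whose exponent is
  \<open>4 * t * t + 2 * t\<close>.\<close>

lemma int_size_tableau_le:
  assumes v: "\<And>l. l < n + n * n + n * n * n \<Longrightarrow> \<bar>v l\<bar> \<le> 2 ^ (2 * t)"
    and n: "n \<le> t"
  shows "int_size (pivot_det n (system_matrix n v) D) \<le> 4 * t * t + 2 * t + 2"
    and "k \<le> n \<Longrightarrow> int_size (tableau n (system_matrix n v) D i k) \<le> 4 * t * t + 2 * t + 2"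
proof -
  let ?h = "2 ^ (3 * t + 2) :: int"
  have h: "\<bar>system_matrix n v i k\<bar> \<le> ?h" if "i < n" "k \<le> n" for i k
    unfolding system_matrix_def using v n that by (intro abs_sum_contribution_le) simp_all
  have h1: "1 \<le> ?h" by (rule one_le_power) simp
  have "int n \<le> int t" using n by simp
  also have "\<dots> \<le> 2 ^ t" using of_nat_less_two_power[of t, where 'a = int] by simp
  finally have n2: "int n \<le> 2 ^ t" .
  have "(fact n :: int) * ?h ^ n \<le> int n ^ n * ?h ^ n"
    using fact_le_power[of n, where 'a = int] by (intro mult_right_mono) simp_all
  also have "\<dots> = (int n * ?h) ^ n" by (simp add: power_mult_distrib)
  also have "\<dots> \<le> (2 ^ t * ?h) ^ n"
    using n2 by (intro power_mono mult_right_mono) simp_all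
  also have "\<dots> \<le> (2 ^ t * ?h) ^ t"
    using n unfolding power_add[symmetric] by (intro power_increasing one_le_power) simp_all
  also have "\<dots> = 2 ^ (4 * t * t + 2 * t)"
    unfolding power_add[symmetric] power_mult[symmetric]
    by (rule arg_cong[where f = "power 2"]) (simp add: algebra_simps)
  finally have bound: "fact n * ?h ^ n \<le> 2 ^ (4 * t * t + 2 * t)" .
  show "int_size (pivot_det n (system_matrix n v) D) \<le> 4 * t * t + 2 * t + 2"
    by (intro int_size_leI order_trans[OF abs_pivot_det_le bound] h h1)
  show "int_size (tableau n (system_matrix n v) D i k) \<le> 4 * t * t + 2 * t + 2" if "k \<le> n"
    by (intro int_size_leI order_trans[OF abs_tableau_le bound] h h1 that)
qed

lemma bounded_input_state:
  assumes "input_size zs < w"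
  shows "bounded_state w (input_state zs)"
  unfolding bounded_state_def
proof (intro allI)
  fix x i
  have "int_size (int (length zs)) \<le> w" "int_size 0 \<le> w"
    using int_size_of_nat[of "length zs"] int_size_of_nat[of 0] length_le_input_size[of zs] assms by simp_all
  moreover have "int_size (zs ! nat (i - 1)) \<le> w" if "1 \<le> i" "i \<le> int (length zs)"
  proof -
    have "zs ! nat (i - 1) \<in> set zs" using that by (intro nth_mem) simp
    then show ?thesis using int_size_le_input_size assms by fastforce
  qed
  ultimately show "int_size (input_state zs x i) \<le> w"
    by (simp add: input_state_def)
qed

definition clearing_com :: com where
  "clearing_com = Seq read_com (Seq matrix_com (Seq solve_com output_com))"

text \<open>The value of \<open>w\<close> is dictated by the tableau entries. Loop counts fit below
  it because the input lists every notional, zeros included, and so has at least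
  \<open>n + n * n\<close> entries of positive length.\<close>

lemma achieves_clearing:
  fixes zs :: "int list"
  defines "t \<equiv> input_size zs"
  assumes fin: "financial_network N" and d: "central_cds_debtor N d" and cov: "all_cds_covered N"
    and zs: "encodes_network zs N"
  shows "achieves (4 * t * t + 2 * t + 3) clearing_com
    (\<lambda>s. \<exists>ys rs. has_output s ys \<and> encodes_rats ys rs \<and> clearing_recovery_rate_vector N rs)
    (input_state zs)" (is "achieves ?w _ ?Q _")
proof -
  define n where "n = nbanks N"
  define c where "c = length (network_data N)"
  obtain ds where zs': "zs = int n # ds" and ds: "encodes_rats ds (network_data N)"
    using zs by (auto simp: encodes_network_def n_def)
  have len: "length ds = 2 * c" using ds by (simp add: encodes_rats_def c_def)
  have c: "c = n + n * n + n * n * n" by (simp add: c_def n_def length_network_data)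
  have dst: "input_size ds \<le> t" by (simp add: t_def zs' input_size_def)
  have ct: "Suc (2 * c) \<le> t" using length_le_input_size[of zs] by (simp add: t_def zs' len)
  have nt: "n + n * n \<le> t" using ct c by simp
  have tt: "t \<le> t * t" by simp
  let ?g = "denominator_prod ds c"
  have g: "0 < ?g" using denominator_prod_pos[OF ds] by (simp add: c_def)
  have scaled: "\<bar>scaled_numerator ds c l\<bar> \<le> 2 ^ (2 * t)" if "l < c" for l
    using dst by (intro order_trans[OF abs_scaled_numerator_le[OF len that] power_increasing]) simp_all
  have read: "achieves ?w read_com (\<lambda>s. s ''n'' 0 = int n \<and> s ''m'' 0 = int (Suc n) \<and>
      s ''S'' = (\<lambda>_. 0) \<and> s ''d'' = (\<lambda>_. 0) \<and>
      (\<forall>l<c. s ''v'' (int l) = scaled_numerator ds c l)) (input_state zs)"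
    unfolding zs'
  proof (rule achieves_read[OF len])
    show "Suc n < ?w" "2 * c < ?w" using nt ct by simp_all
    fix k assume "k \<le> c"
    then have "\<bar>denominator_prod ds k\<bar> \<le> 2 ^ t"
      using len dst by (intro order_trans[OF abs_denominator_prod_le power_increasing]) simp_all
    then have "int_size (denominator_prod ds k) \<le> t + 2" by (rule int_size_leI)
    then show "int_size (denominator_prod ds k) \<le> ?w" by simp
  next
    fix l assume "l < c"
    then have "int_size (scaled_numerator ds c l) \<le> 2 * t + 2" by (intro int_size_leI scaled)
    then show "int_size (scaled_numerator ds c l) \<le> ?w" by simp
  qed
  have main: "achieves ?w (Seq matrix_com (Seq solve_com output_com)) ?Q s"
    if s: "s ''n'' 0 = int n" "s ''m'' 0 = int (Suc n)" "s ''S'' = (\<lambda>_. 0)" "s ''d'' = (\<lambda>_. 0)"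
      and vs: "\<forall>l<c. s ''v'' (int l) = scaled_numerator ds c l" for s
  proof -
    define v where "v = (\<lambda>l. s ''v'' (int l))"
    let ?a = "system_matrix n v"
    have v: "v l = scaled_numerator ds c l" if "l < c" for l using vs that by (simp add: v_def)
    have vb: "\<bar>v l\<bar> \<le> 2 ^ (2 * t)" if "l < n + n * n + n * n * n" for l
      using scaled[of l] v[of l] that c by simp
    have a: "deficit_matrix N ?g ?a"
      unfolding n_def c_def by (rule deficit_matrix_system_matrix[OF ds]) (simp add: v c_def)
    have inv: "pivot_invariant n ?a {}"
      using deficit_matrix_off_diagonal[OF fin d cov g a] deficit_matrix_row_sum[OF fin d cov g a]
      by (intro pivot_invariant_empty) (simp_all add: n_def)
    have nt': "n \<le> t" using nt by simp
    have size: "int_size (pivot_det n ?a D) \<le> 4 * t * t + 2 * t + 2"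
        "k \<le> n \<Longrightarrow> int_size (tableau n ?a D i k) \<le> 4 * t * t + 2 * t + 2" for D i k
      using int_size_tableau_le[of n v t] vb nt' by blast+
    have matrix: "achieves ?w matrix_com (holds_tableau n ?a {}) s"
      unfolding v_def
    proof (rule achieves_matrix[OF s])
      show "pivot_invariant n (system_matrix n (\<lambda>l. s ''v'' (int l))) {}"
        using inv by (simp add: v_def)
      show "Suc (n * Suc n) < ?w" using nt by simp
      fix l i k assume lik: "l \<le> n" "i < n" "k \<le> n"
      then have "\<bar>\<Sum>j<l. contribution n v j i k\<bar> \<le> 2 ^ (3 * t + 2)"
        using vb nt' by (intro abs_sum_contribution_le) simp_all
      then have "int_size (\<Sum>j<l. contribution n v j i k) \<le> 3 * t + 2 + 2" by (rule int_size_leI)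
      also have "\<dots> \<le> ?w" using tt ct unfolding mult.assoc by linarith
      finally show "int_size (\<Sum>j<l. contribution n (\<lambda>l. s ''v'' (int l)) j i k) \<le> ?w"
        by (simp add: v_def)
    qed
    have solve: "achieves ?w solve_com (\<lambda>s'. \<exists>D. holds_tableau n ?a D s' \<and>
        (\<forall>i<n. i \<notin> D \<longrightarrow> tableau n ?a D i n \<le> 0)) s" if "holds_tableau n ?a {} s" for s
    proof (rule achieves_solve[OF that])
      show "Suc n * Suc n < ?w" using nt ct by simp
      show "int_size (tableau n ?a D i k) \<le> ?w" if "k \<le> n" for i k D
        by (rule le_trans[OF size(2)[OF that]]) simp
    qed
    have out: "achieves ?w output_com ?Q s"
      if tab: "holds_tableau n ?a D s" and final: "\<forall>i<n. i \<notin> D \<longrightarrow> tableau n ?a D i n \<le> 0" for s D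
    proof -
      let ?\<Delta> = "pivot_det n ?a D" and ?y = "pivot_solution n ?a D"
      let ?ys = "concat (map (\<lambda>i. [?\<Delta> - ?y i, ?\<Delta>]) [0..<n])"
      let ?rs = "map (\<lambda>i. of_int (?\<Delta> - ?y i) / of_int ?\<Delta> :: rat) [0..<n]"
      have inv: "pivot_invariant n ?a D" using tab by (simp add: holds_tableau_def)
      have "encodes_rats ?ys ?rs"
        unfolding encodes_rats_def
      proof (intro conjI allI impI)
        show "length ?ys = 2 * length ?rs"
          by (subst length_concat_uniform[where m = 2]) simp_all
        fix i assume "i < length ?rs"
        then have i: "i < n" by simp
        have "?ys ! (i * 2 + j) = [?\<Delta> - ?y i, ?\<Delta>] ! j" if "j < 2" for j
          using i that by (intro nth_concat_uniform) simp_all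
        from this[of 0] this[of 1]
        have ys: "?ys ! (2 * i) = ?\<Delta> - ?y i" "?ys ! (2 * i + 1) = ?\<Delta>"
          by (simp_all add: mult.commute)
        show "0 < ?ys ! (2 * i + 1)" unfolding ys using inv by (simp add: pivot_invariant_def)
        show "?rs ! i = of_int (?ys ! (2 * i)) / of_int (?ys ! (2 * i + 1))"
          unfolding ys using i by simp
      qed
      moreover have "clearing_recovery_rate_vector N ?rs"
        unfolding clearing_recovery_rate_vector_def
      proof
        show "clearing N (\<lambda>i. ?rs ! i)"
          using inv final by (intro clearing_pivot_solution[OF fin d cov g a, of D]) (simp_all add: n_def)
      qed (simp add: n_def)
      ultimately have Q: "?Q s'" if "has_output s' ?ys" for s' using that by blast
      show ?thesis
        by (rule achieves_mono[OF achieves_output[OF tab] Q]) (use nt ct size(1)[of D] in simp_all)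
    qed
    show ?thesis
      by (rule achieves_Seq, rule achieves_mono[OF matrix], rule achieves_Seq,
          rule achieves_mono[OF solve], assumption, elim exE conjE, rule out, assumption+)
  qed
  show ?thesis
    unfolding clearing_com_def
    by (rule achieves_Seq, rule achieves_mono[OF read], elim conjE, rule main)
qed

theorem theorem5:
  "solvable_in_poly_time encodes_network encodes_rats
     (\<lambda>N. financial_network N \<and> nondegenerate N \<and>
          central_cds_debtor_property N \<and> all_cds_covered N)
     clearing_recovery_rate_vector"
  unfolding solvable_in_poly_time_def
\<comment> \<open>The polynomial \<open>[:3, 2, 4:]\<close> is the bound
  \<open>4 * t * t + 2 * t + 3\<close> on cells and iterations, with ascending coefficients.\<close>
proof (rule exI[of _ clearing_com], rule exI[of _ "pcompose (time_poly clearing_com) [:3, 2, 4:]"],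
    intro allI impI, elim conjE)
  fix N zs
  assume "financial_network N" "central_cds_debtor_property N" "all_cds_covered N"
    and zs: "encodes_network zs N"
  then have "achieves (poly [:3, 2, 4:] (input_size zs)) clearing_com
      (\<lambda>s. \<exists>ys rs. has_output s ys \<and> encodes_rats ys rs \<and> clearing_recovery_rate_vector N rs)
      (input_state zs)"
    using achieves_clearing by (auto simp: central_cds_debtor_property_def algebra_simps)
  moreover have "bounded_state (poly [:3, 2, 4:] (input_size zs)) (input_state zs)"
    by (rule bounded_input_state) simp
  ultimately show "\<exists>t s. exec clearing_com (input_state zs) t s \<and>
      t \<le> poly (pcompose (time_poly clearing_com) [:3, 2, 4:]) (input_size zs) \<and>
      (\<exists>ys rs. has_output s ys \<and> encodes_rats ys rs \<and> clearing_recovery_rate_vector N rs)"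
    unfolding achieves_def poly_pcompose by blast
qed

end
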